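(* Let $\Omega\subset\mathbb{R}^2$ be a bounded convex domain that maximizes $\|\nabla u\|_{L^\infty(\Omega)}/|\Omega|^{1/2}$ among all bounded convex planar domains (where $u$ is the torsion function of the domain). Suppose that for some $\alpha>0$ the boundary $\partial\Omega$ is $C^{1+\alpha}$ in a neighborhood of an extremal point of $\Omega$. Then, for any $\beta\in(0,1)$, $\partial\Omega$ does not admit two adjacent $C^{1+\beta}$-smooth subarcs that meet at an (interior) angle strictly smaller than $\pi/2$.
   Context: For a bounded convex domain $\Omega\subset\mathbb{R}^2$, the torsion function $u$ of $\Omega$ is the unique solution of $-\Delta u=1$ in $\Omega$, $u=0$ on $\partial\Omega$. $|\Omega|$ denotes area. One has $\|\nabla u\|_{L^\infty(\Omega)}=\|\partial u/\partial\mathbf n\|_{L^\infty(\partial\Omega)}$, with $\mathbf n$ the outward unit normal. An extremal (maximizing) point is a point of $\partial\Omega$ at which this maximal value is attained; at a boundary point near which $\partial\Omega$ is $C^{1+\alpha}$, $\nabla u$ extends continuously to the boundary, and being extremal means $|\nabla u(p)|=\|\nabla u\|_{L^\infty(\Omega)}$. *)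

theory Defs
  imports "HOL-Analysis.Analysis" "HOL-Probability.Essential_Supremum"
begin

definition bounded_convex_domain :: "(real^2) set \<Rightarrow> bool" where
  "bounded_convex_domain \<Omega> \<longleftrightarrow> open \<Omega> \<and> convex \<Omega> \<and> bounded \<Omega> \<and> \<Omega> \<noteq> {}"

definition grad :: "(real^2 \<Rightarrow> real) \<Rightarrow> real^2 \<Rightarrow> real^2" where
  "grad u x = (THE D. GDERIV u x :> D)"

(* The divergence of the gradient field; meaningful where u is twice differentiable. *)
definition laplacian :: "(real^2 \<Rightarrow> real) \<Rightarrow> real^2 \<Rightarrow> real" where
  "laplacian u x = (\<Sum>b\<in>Basis. frechet_derivative (grad u) (at x) b \<bullet> b)"

definition C2_on :: "(real^2) set \<Rightarrow> (real^2 \<Rightarrow> real) \<Rightarrow> bool" where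
  "C2_on \<Omega> u \<longleftrightarrow>
     (\<forall>x\<in>\<Omega>. u differentiable (at x) \<and> grad u differentiable (at x)) \<and>
     (\<forall>b\<in>Basis. continuous_on \<Omega> (\<lambda>x. frechet_derivative (grad u) (at x) b))"

(* The classical solution of the Dirichlet problem, of class C^2 inside and continuous up to the
   boundary.  Only the restriction of u to the closure of the domain is determined. *)
definition torsion_function :: "(real^2) set \<Rightarrow> (real^2 \<Rightarrow> real) \<Rightarrow> bool" where
  "torsion_function \<Omega> u \<longleftrightarrow>
     continuous_on (closure \<Omega>) u \<and> C2_on \<Omega> u \<and>
     (\<forall>x\<in>\<Omega>. - laplacian u x = 1) \<and> (\<forall>x\<in>frontier \<Omega>. u x = 0)"

(* Extended-real valued, so that finiteness is not built into the definition. *)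
definition Linf_norm :: "(real^2) set \<Rightarrow> (real^2 \<Rightarrow> real^2) \<Rightarrow> ereal" where
  "Linf_norm \<Omega> f = esssup (lebesgue_on \<Omega>) (\<lambda>x. ereal (norm (f x)))"

definition gradient_ratio :: "(real^2) set \<Rightarrow> (real^2 \<Rightarrow> real) \<Rightarrow> ereal" where
  "gradient_ratio \<Omega> u = Linf_norm \<Omega> (grad u) / ereal (sqrt (measure lebesgue \<Omega>))"

(* The gradient at a boundary point is the limit of the gradient from inside the domain. *)
definition extremal_point :: "(real^2) set \<Rightarrow> (real^2 \<Rightarrow> real) \<Rightarrow> real^2 \<Rightarrow> bool" where
  "extremal_point \<Omega> u p \<longleftrightarrow> p \<in> frontier \<Omega> \<and>
     (\<exists>g. (grad u \<longlongrightarrow> g) (at p within \<Omega>) \<and> ereal (norm g) = Linf_norm \<Omega> (grad u))"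

(* One-sided derivatives at the end points of the parameter interval. *)
abbreviation velocity :: "(real \<Rightarrow> real^2) \<Rightarrow> real \<Rightarrow> real^2" where
  "velocity \<gamma> t \<equiv> vector_derivative \<gamma> (at t within {0..1})"

(* A simple arc, regular and of class C^{1+s} up to its end points; s is a Hoelder exponent, used
   for 0 < s <= 1.  For s > 0 the Hoelder bound contains the continuity of the velocity. *)
definition C1_holder_arc :: "real \<Rightarrow> (real \<Rightarrow> real^2) \<Rightarrow> bool" where
  "C1_holder_arc s \<gamma> \<longleftrightarrow> arc \<gamma> \<and>
     (\<forall>t\<in>{0..1}. \<gamma> differentiable (at t within {0..1}) \<and> velocity \<gamma> t \<noteq> 0) \<and>
     (\<exists>C. \<forall>t\<in>{0..1}. \<forall>t'\<in>{0..1}.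
        norm (velocity \<gamma> t - velocity \<gamma> t') \<le> C * \<bar>t - t'\<bar> powr s)"

definition C1_holder_boundary_near :: "real \<Rightarrow> (real^2) set \<Rightarrow> real^2 \<Rightarrow> bool" where
  "C1_holder_boundary_near s \<Omega> p \<longleftrightarrow>
     (\<exists>U \<gamma>. open U \<and> p \<in> U \<and> C1_holder_arc s \<gamma> \<and> frontier \<Omega> \<inter> U = \<gamma> ` {0<..<1})"

definition vec_angle :: "real^2 \<Rightarrow> real^2 \<Rightarrow> real" where
  "vec_angle v w = arccos ((v \<bullet> w) / (norm v * norm w))"

(* Both arcs are parametrized starting from their common vertex, so both initial velocities point
   away from it.  Since the domain is convex, its interior angle at the vertex is at most pi, hence
   is the unoriented angle between the two tangent rays. *)
definition boundary_corner ::
    "real \<Rightarrow> (real^2) set \<Rightarrow> (real \<Rightarrow> real^2) \<Rightarrow> (real \<Rightarrow> real^2) \<Rightarrow> real \<Rightarrow> bool" where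
  "boundary_corner s \<Omega> \<gamma>\<^sub>1 \<gamma>\<^sub>2 \<theta> \<longleftrightarrow>
     C1_holder_arc s \<gamma>\<^sub>1 \<and> C1_holder_arc s \<gamma>\<^sub>2 \<and>
     path_image \<gamma>\<^sub>1 \<subseteq> frontier \<Omega> \<and> path_image \<gamma>\<^sub>2 \<subseteq> frontier \<Omega> \<and>
     pathstart \<gamma>\<^sub>1 = pathstart \<gamma>\<^sub>2 \<and> path_image \<gamma>\<^sub>1 \<inter> path_image \<gamma>\<^sub>2 = {pathstart \<gamma>\<^sub>1} \<and>
     \<theta> = vec_angle (velocity \<gamma>\<^sub>1 0) (velocity \<gamma>\<^sub>2 0)"

end

theory Submission
  imports Defs
begin

text \<open>For small \<open>c > 0\<close> the maximizer \<open>\<Omega>\<close> is compared with its superlevel set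
  \<open>\<Omega>\<^sub>c = {u > c}\<close>, whose torsion function is \<open>u - c\<close>. It is convex because the cube root of \<open>u\<close>
  is concave, by the Korevaar--Kennington concavity maximum principle. Convexity of the level lines
  gives \<open>u\<^sub>\<nu>\<^sub>\<nu> \<ge> -1\<close> in the direction \<open>\<nu>\<close> of the gradient, so the maximum of \<open>\<bar>\<nabla>u\<bar>\<^sup>2\<close>
  drops by at most a constant times \<open>c\<close> in passing to \<open>\<Omega>\<^sub>c\<close>. The removed area, however, is not \<open>O(c)\<close>
  at a corner with angle less than \<open>\<pi>/2\<close>: with \<open>x\<close> measured along one side and \<open>y\<close> the distance
  to it, \<open>\<Omega>\<close> lies in a wedge \<open>0 < y < a x\<close>, where the barrier \<open>y (a x - y)\<close> bounds \<open>u\<close>; hence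
  \<open>u \<le> c\<close> wherever \<open>a x y \<le> c\<close>, and this region has area of order \<open>c log(1/c)\<close>.\<close>

section \<open>Functions with a gradient and a Hessian field\<close>

text \<open>The area loss only has to beat every multiple of c. So a number \<open>N\<close> of
  rectangles is fixed first, from the supremum of the gradient, the area and the slope
  \<open>a\<close>, and c is taken small afterwards; no asymptotic expansion in c enters. The angle
  matters at both ends. Below \<pi>/2, the second tangent has a finite slope \<open>a\<close> over
  the first side, so that the wedge lies over x > 0 and a quadratic polynomial serves as barrier.
  The angle 0 has to be excluded by an argument: two boundary arcs of a convex domain with the same
  tangent ray at the vertex would meet again. The obstacle is that the region a x y \<le> c, however
  large, counts only where it lies in the domain, while the first side is merely tangent to the
  x-axis. What tangency gives is that for each \<delta> > 0 the cone \<delta> x < y < b x lies in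
  the domain for x < \<eta>(\<delta>). Finitely many rectangles under the hyperbola fit into one
  such cone, which dictates the order of choices: \<open>N\<close>, then \<delta>, then \<eta>, then
  c.\<close>

definition second_order ::
    "'a::euclidean_space set \<Rightarrow> ('a \<Rightarrow> real) \<Rightarrow> ('a \<Rightarrow> 'a) \<Rightarrow> ('a \<Rightarrow> 'a \<Rightarrow> 'a) \<Rightarrow> bool" where
  "second_order S u G H \<longleftrightarrow>
     (\<forall>x\<in>S. (u has_derivative (\<lambda>h. G x \<bullet> h)) (at x) \<and> (G has_derivative H x) (at x))"

lemma second_order_subset: "second_order S u G H \<Longrightarrow> T \<subseteq> S \<Longrightarrow> second_order T u G H"
  unfolding second_order_def by blast

lemma second_order_diff:
  assumes "second_order S u G H" "second_order S u' G' H'"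
  shows "second_order S (\<lambda>x. u x - u' x) (\<lambda>x. G x - G' x) (\<lambda>x h. H x h - H' x h)"
  using assms unfolding second_order_def
  by (auto intro!: derivative_eq_intros simp: inner_diff_left)

lemma second_order_continuous:
  assumes "second_order S u G H"
  shows "continuous_on S u" "continuous_on S G"
  using assms unfolding second_order_def
  by (meson continuous_at_imp_continuous_on has_derivative_continuous)+

lemma second_order_line:
  assumes "second_order S u G H" "x + s *\<^sub>R \<xi> \<in> S"
  shows "((\<lambda>s. u (x + s *\<^sub>R \<xi>)) has_real_derivative G (x + s *\<^sub>R \<xi>) \<bullet> \<xi>) (at s)"
    and "((\<lambda>s. G (x + s *\<^sub>R \<xi>) \<bullet> \<xi>) has_real_derivative H (x + s *\<^sub>R \<xi>) \<xi> \<bullet> \<xi>) (at s)"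
proof -
  let ?p = "x + s *\<^sub>R \<xi>"
  have u: "(u has_derivative (\<lambda>h. G ?p \<bullet> h)) (at ?p)" and G: "(G has_derivative H ?p) (at ?p)"
    using assms unfolding second_order_def by auto
  have l: "((\<lambda>s. x + s *\<^sub>R \<xi>) has_derivative (\<lambda>r. r *\<^sub>R \<xi>)) (at s)"
    by (auto intro!: derivative_eq_intros)
  have lin: "linear (H ?p)" using G has_derivative_linear by blast
  show "((\<lambda>s. u (x + s *\<^sub>R \<xi>)) has_real_derivative G ?p \<bullet> \<xi>) (at s)"
    using has_derivative_compose[OF l u]
    by (simp add: has_field_derivative_def mult.commute[of _ "G ?p \<bullet> \<xi>"])
  have "((\<lambda>s. G (x + s *\<^sub>R \<xi>) \<bullet> \<xi>) has_derivative (\<lambda>r. H ?p (r *\<^sub>R \<xi>) \<bullet> \<xi>)) (at s)"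
    by (rule has_derivative_inner_left[OF has_derivative_compose[OF l G]])
  then show "((\<lambda>s. G (x + s *\<^sub>R \<xi>) \<bullet> \<xi>) has_real_derivative H ?p \<xi> \<bullet> \<xi>) (at s)"
    by (simp add: has_field_derivative_def linear_cmul[OF lin] mult.commute[of _ "H ?p \<xi> \<bullet> \<xi>"])
qed

text \<open>Since \<psi> vanishes at 0, a negative \<open>D\<close> would make \<psi> negative just
  to the right of 0, and the mean value theorem would push \<phi> below its minimum.
  Differentiability of \<psi> at the single point 0 is enough for this.\<close>

lemma second_derivative_local_min:
  fixes \<phi> \<psi> :: "real \<Rightarrow> real"
  assumes "eventually (\<lambda>s. (\<phi> has_real_derivative \<psi> s) (at s)) (nhds 0)"
    and "(\<psi> has_real_derivative D) (at 0)"
    and "eventually (\<lambda>s. \<phi> 0 \<le> \<phi> s) (nhds 0)"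
  shows "\<psi> 0 = 0" "D \<ge> 0"
proof -
  obtain d where d: "d > 0" "\<And>s. \<bar>s\<bar> < d \<Longrightarrow> (\<phi> has_real_derivative \<psi> s) (at s) \<and> \<phi> 0 \<le> \<phi> s"
    using eventually_conj[OF assms(1,3)] by (auto simp: eventually_nhds_metric dist_real_def)
  show 0: "\<psi> 0 = 0"
    using DERIV_local_min[of \<phi> "\<psi> 0" 0 d] d by auto
  show "D \<ge> 0"
  proof (rule ccontr)
    assume "\<not> D \<ge> 0"
    then obtain d' where d': "d' > 0" "\<And>h. 0 < h \<Longrightarrow> h < d' \<Longrightarrow> \<psi> h < 0"
      using DERIV_neg_dec_right[OF assms(2)] 0 by auto
    define h where "h = min d d' / 2"
    have h: "0 < h" "h < d" "h < d'" using d d' by (auto simp: h_def)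
    have "\<exists>z. 0 < z \<and> z < h \<and> \<phi> h - \<phi> 0 = (h - 0) * \<psi> z"
      by (rule MVT2) (use h d in auto)
    then obtain z where z: "0 < z" "z < h" "\<phi> h - \<phi> 0 = h * \<psi> z" by auto
    have "\<psi> z < 0" using d' z h by auto
    then have "h * \<psi> z < 0" using h by (simp add: mult_pos_neg)
    moreover have "\<phi> h \<ge> \<phi> 0" using d h by auto
    ultimately show False using z by simp
  qed
qed

lemma eventually_line_in_open:
  fixes x :: "'a::real_normed_vector"
  assumes "open S" "x \<in> S"
  shows "eventually (\<lambda>s. x + s *\<^sub>R \<xi> \<in> S) (nhds (0::real))"
proof -
  have "open ((\<lambda>s::real. x + s *\<^sub>R \<xi>) -` S)"
    by (intro continuous_open_vimage[OF assms(1)] continuous_intros)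
  then show ?thesis using assms(2) unfolding eventually_nhds by fastforce
qed

lemma second_order_local_min:
  assumes "second_order S u G H" "open S" "x \<in> S" "eventually (\<lambda>y. u x \<le> u y) (nhds x)"
  shows "G x = 0" "0 \<le> H x \<xi> \<bullet> \<xi>"
proof -
  have main: "G x \<bullet> \<xi> = 0 \<and> 0 \<le> H x \<xi> \<bullet> \<xi>" for \<xi>
  proof -
    obtain U where U: "open U" "x \<in> U" "\<And>y. y \<in> U \<Longrightarrow> u x \<le> u y"
      using assms(4) unfolding eventually_nhds by auto
    have "eventually (\<lambda>s. u (x + 0 *\<^sub>R \<xi>) \<le> u (x + s *\<^sub>R \<xi>)) (nhds (0::real))"
      by (rule eventually_mono[OF eventually_line_in_open[OF U(1,2), of \<xi>]]) (use U(3) in simp)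
    moreover have "eventually (\<lambda>s. ((\<lambda>s. u (x + s *\<^sub>R \<xi>)) has_real_derivative G (x + s *\<^sub>R \<xi>) \<bullet> \<xi>) (at s)) (nhds 0)"
      by (rule eventually_mono[OF eventually_line_in_open[OF assms(2,3)] second_order_line(1)[OF assms(1)]])
    ultimately show ?thesis
      using second_derivative_local_min[of "\<lambda>s. u (x + s *\<^sub>R \<xi>)" "\<lambda>s. G (x + s *\<^sub>R \<xi>) \<bullet> \<xi>"]
        second_order_line(2)[OF assms(1), of x 0 \<xi>] assms(3) by force
  qed
  show "G x = 0" using main[of "G x"] by simp
  show "0 \<le> H x \<xi> \<bullet> \<xi>" using main by blast
qed

text \<open>At an interior minimum every second directional derivative is nonnegative, hence so is
  the trace. The strict sign of the trace makes this an immediate contradiction; barriers below are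
  therefore chosen with a strict gap in the trace. The value 0 inside is excluded because it would
  itself be an interior minimum.\<close>

lemma strict_minimum_principle:
  fixes S :: "'a::euclidean_space set"
  assumes S: "open S" "bounded S" and w: "second_order S w G H" "continuous_on (closure S) w"
    and tr: "\<And>x. x \<in> S \<Longrightarrow> (\<Sum>b\<in>Basis. H x b \<bullet> b) < 0"
    and bd: "\<And>x. x \<in> frontier S \<Longrightarrow> 0 \<le> w x" and "x \<in> S"
  shows "0 < w x"
proof -
  have c: "compact (closure S)" using S by (simp add: compact_closure)
  obtain m where m: "m \<in> closure S" "\<And>y. y \<in> closure S \<Longrightarrow> w m \<le> w y"
    using continuous_attains_inf[OF c _ w(2)] \<open>x \<in> S\<close> closure_subset by blast
  have ns: False if "z \<in> S" "\<And>y. y \<in> closure S \<Longrightarrow> w z \<le> w y" for z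
  proof -
    have "eventually (\<lambda>y. w z \<le> w y) (nhds z)"
      unfolding eventually_nhds using that S closure_subset by blast
    then have "0 \<le> (\<Sum>b\<in>Basis. H z b \<bullet> b)"
      using second_order_local_min(2)[OF w(1) S(1) that(1)] by (intro sum_nonneg) auto
    with tr[OF that(1)] show False by simp
  qed
  then have "m \<notin> S" using m by blast
  then have "m \<in> frontier S" using m S by (simp add: frontier_def interior_open)
  then have "0 \<le> w m" using bd by blast
  moreover have "w m \<le> w x" using m \<open>x \<in> S\<close> closure_subset by blast
  moreover have "w x \<noteq> 0"
  proof
    assume "w x = 0"
    then show False using ns[OF \<open>x \<in> S\<close>] m(2) \<open>0 \<le> w m\<close> by force
  qed
  ultimately show ?thesis by simp
qed

lemma second_order_norm_sq:
  "second_order S (\<lambda>z. k * (norm (z - x))\<^sup>2) (\<lambda>z. (2 * k) *\<^sub>R (z - x)) (\<lambda>z h. (2 * k) *\<^sub>R h)"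
  unfolding second_order_def
  by (auto intro!: derivative_eq_intros simp: power2_norm_eq_inner inner_commute algebra_simps)

lemma second_order_add_const:
  "second_order S u G H \<Longrightarrow> second_order S (\<lambda>x. u x + c) G H"
  unfolding second_order_def by (auto intro!: derivative_eq_intros)

lemma second_order_linear: "second_order S u G H \<Longrightarrow> x \<in> S \<Longrightarrow> linear (H x)"
  unfolding second_order_def using has_derivative_linear by blast

text \<open>Both fields come from differentiating v^3 = u twice: 3 v^2 Dv = Du, and 3 v^2 D^2v plus
  6 v times the tensor square of Dv equals D^2u.\<close>

lemma second_order_root3:
  fixes u :: "'a::euclidean_space \<Rightarrow> real"
  assumes "second_order S u G H" and pos: "\<And>x. x \<in> S \<Longrightarrow> 0 < u x"
  defines "v \<equiv> \<lambda>x. root 3 (u x)"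
  defines "G' \<equiv> \<lambda>x. inverse (3 * (v x)\<^sup>2) *\<^sub>R G x"
  defines "H' \<equiv> \<lambda>x h. inverse (3 * (v x)\<^sup>2) *\<^sub>R H x h - (2 / v x * (G' x \<bullet> h)) *\<^sub>R G' x"
  shows "second_order S v G' H'"
  unfolding second_order_def
proof (intro ballI)
  fix x assume x: "x \<in> S"
  have u: "(u has_derivative (\<lambda>h. G x \<bullet> h)) (at x)" and G: "(G has_derivative H x) (at x)"
    using assms(1) x unfolding second_order_def by auto
  have vp: "v x > 0" using pos[OF x] by (simp add: v_def)
  have "(root 3 has_real_derivative inverse (3 * (v x)\<^sup>2)) (at (u x))"
    using DERIV_real_root[of 3 "u x"] pos[OF x] by (simp add: v_def)
  then have "(root 3 has_derivative (\<lambda>h. inverse (3 * (v x)\<^sup>2) * h)) (at (u x))"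
    unfolding has_field_derivative_def .
  from has_derivative_compose[OF u this]
  have v: "(v has_derivative (\<lambda>h. G' x \<bullet> h)) (at x)"
    by (simp add: v_def G'_def)
  have k: "((\<lambda>x. inverse (3 * (v x)\<^sup>2)) has_derivative
      (\<lambda>h. - (inverse (3 * (v x)\<^sup>2) * (6 * v x * (G' x \<bullet> h)) * inverse (3 * (v x)\<^sup>2)))) (at x)"
    using vp by (auto intro!: derivative_eq_intros v simp: algebra_simps)
  have eq: "(inverse (3 * (v x)\<^sup>2) *\<^sub>R H x h +
      (- (inverse (3 * (v x)\<^sup>2) * (6 * v x * (G' x \<bullet> h)) * inverse (3 * (v x)\<^sup>2))) *\<^sub>R G x) = H' x h" for h
  proof -
    have "(- (inverse (3 * (v x)\<^sup>2) * (6 * v x * (G' x \<bullet> h)) * inverse (3 * (v x)\<^sup>2))) *\<^sub>R G x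
      = (- (inverse (3 * (v x)\<^sup>2) * (6 * v x * (G' x \<bullet> h)))) *\<^sub>R G' x"
      unfolding G'_def by simp
    also have "- (inverse (3 * (v x)\<^sup>2) * (6 * v x * (G' x \<bullet> h))) = - (2 / v x * (G' x \<bullet> h))"
      using vp by (simp add: field_simps power2_eq_square)
    finally show ?thesis by (simp add: H'_def)
  qed
  have "(G' has_derivative (\<lambda>h. inverse (3 * (v x)\<^sup>2) *\<^sub>R H x h +
      (- (inverse (3 * (v x)\<^sup>2) * (6 * v x * (G' x \<bullet> h)) * inverse (3 * (v x)\<^sup>2))) *\<^sub>R G x)) (at x)"
    using has_derivative_scaleR[OF k G] by (simp add: G'_def)
  then have "(G' has_derivative H' x) (at x)" unfolding eq .
  with v show "(v has_derivative (\<lambda>h. G' x \<bullet> h)) (at x) \<and> (G' has_derivative H' x) (at x)" by blast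
qed

text \<open>Move \<open>x\<close> by s a \<xi> and \<open>y\<close> by s b \<xi>; then
  \<open>z\<close> moves by s (l a + (1 - l) b) \<xi>, and the concavity defect has a minimum at s =
  0. The first derivative with (a, b) = (1, 0) and (0, 1) equates the gradients. The second
  derivative gives the inequality, in which the free ratio of \<open>a\<close> to \<open>b\<close>
  is what carries the harmonic mean later.\<close>

lemma three_point_minimum:
  fixes v :: "'a::euclidean_space \<Rightarrow> real"
  assumes v: "second_order S v G H" and S: "open S" and xyz: "x \<in> S" "y \<in> S" "z \<in> S"
    and z: "z = l *\<^sub>R x + (1 - l) *\<^sub>R y" and l: "0 < l" "l < 1"
    and min: "\<And>x' y'. x' \<in> S \<Longrightarrow> y' \<in> S \<Longrightarrow>
      v z - l * v x - (1 - l) * v y \<le> v (l *\<^sub>R x' + (1 - l) *\<^sub>R y') - l * v x' - (1 - l) * v y'"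
  shows "G x = G z" "G y = G z"
    "l * a\<^sup>2 * (H x \<xi> \<bullet> \<xi>) + (1 - l) * b\<^sup>2 * (H y \<xi> \<bullet> \<xi>) \<le> (l * a + (1 - l) * b)\<^sup>2 * (H z \<xi> \<bullet> \<xi>)"
proof -
  have main: "(l * a + (1 - l) * b) * (G z \<bullet> \<xi>) = l * a * (G x \<bullet> \<xi>) + (1 - l) * b * (G y \<bullet> \<xi>) \<and>
    l * a\<^sup>2 * (H x \<xi> \<bullet> \<xi>) + (1 - l) * b\<^sup>2 * (H y \<xi> \<bullet> \<xi>) \<le> (l * a + (1 - l) * b)\<^sup>2 * (H z \<xi> \<bullet> \<xi>)" for a b \<xi>
  proof -
    define m where "m = l * a + (1 - l) * b"
    define \<phi> where "\<phi> s = v (z + s *\<^sub>R (m *\<^sub>R \<xi>)) - l * v (x + s *\<^sub>R (a *\<^sub>R \<xi>)) - (1 - l) * v (y + s *\<^sub>R (b *\<^sub>R \<xi>))" for s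
    define \<psi> where "\<psi> s = G (z + s *\<^sub>R (m *\<^sub>R \<xi>)) \<bullet> (m *\<^sub>R \<xi>) - l * (G (x + s *\<^sub>R (a *\<^sub>R \<xi>)) \<bullet> (a *\<^sub>R \<xi>))
       - (1 - l) * (G (y + s *\<^sub>R (b *\<^sub>R \<xi>)) \<bullet> (b *\<^sub>R \<xi>))" for s
    define D where "D = H z (m *\<^sub>R \<xi>) \<bullet> (m *\<^sub>R \<xi>) - l * (H x (a *\<^sub>R \<xi>) \<bullet> (a *\<^sub>R \<xi>)) - (1 - l) * (H y (b *\<^sub>R \<xi>) \<bullet> (b *\<^sub>R \<xi>))"
    have ev: "eventually (\<lambda>s. z + s *\<^sub>R (m *\<^sub>R \<xi>) \<in> S \<and> x + s *\<^sub>R (a *\<^sub>R \<xi>) \<in> S \<and> y + s *\<^sub>R (b *\<^sub>R \<xi>) \<in> S) (nhds 0)"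
      by (intro eventually_conj eventually_line_in_open S xyz)
    have e1: "eventually (\<lambda>s. (\<phi> has_real_derivative \<psi> s) (at s)) (nhds 0)"
    proof (rule eventually_mono[OF ev])
      fix s assume s: "z + s *\<^sub>R (m *\<^sub>R \<xi>) \<in> S \<and> x + s *\<^sub>R (a *\<^sub>R \<xi>) \<in> S \<and> y + s *\<^sub>R (b *\<^sub>R \<xi>) \<in> S"
      show "(\<phi> has_real_derivative \<psi> s) (at s)"
        unfolding \<phi>_def \<psi>_def
        by (intro DERIV_diff DERIV_cmult second_order_line(1)[OF v]) (use s in auto)
    qed
    have e2: "(\<psi> has_real_derivative D) (at 0)"
    proof -
      have "((\<lambda>s. G (z + s *\<^sub>R (m *\<^sub>R \<xi>)) \<bullet> (m *\<^sub>R \<xi>)) has_real_derivative H z (m *\<^sub>R \<xi>) \<bullet> (m *\<^sub>R \<xi>)) (at 0)"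
           "((\<lambda>s. G (x + s *\<^sub>R (a *\<^sub>R \<xi>)) \<bullet> (a *\<^sub>R \<xi>)) has_real_derivative H x (a *\<^sub>R \<xi>) \<bullet> (a *\<^sub>R \<xi>)) (at 0)"
           "((\<lambda>s. G (y + s *\<^sub>R (b *\<^sub>R \<xi>)) \<bullet> (b *\<^sub>R \<xi>)) has_real_derivative H y (b *\<^sub>R \<xi>) \<bullet> (b *\<^sub>R \<xi>)) (at 0)"
        using second_order_line(2)[OF v, of z 0 "m *\<^sub>R \<xi>"] second_order_line(2)[OF v, of x 0 "a *\<^sub>R \<xi>"]
          second_order_line(2)[OF v, of y 0 "b *\<^sub>R \<xi>"] xyz by auto
      then show ?thesis unfolding \<psi>_def D_def by (intro DERIV_diff DERIV_cmult)
    qed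
    have e3: "eventually (\<lambda>s. \<phi> 0 \<le> \<phi> s) (nhds 0)"
    proof (rule eventually_mono[OF ev])
      fix s assume s: "z + s *\<^sub>R (m *\<^sub>R \<xi>) \<in> S \<and> x + s *\<^sub>R (a *\<^sub>R \<xi>) \<in> S \<and> y + s *\<^sub>R (b *\<^sub>R \<xi>) \<in> S"
      have "l *\<^sub>R (x + s *\<^sub>R (a *\<^sub>R \<xi>)) + (1 - l) *\<^sub>R (y + s *\<^sub>R (b *\<^sub>R \<xi>)) = z + s *\<^sub>R (m *\<^sub>R \<xi>)"
        by (simp add: z m_def algebra_simps)
      then show "\<phi> 0 \<le> \<phi> s" using min[of "x + s *\<^sub>R (a *\<^sub>R \<xi>)" "y + s *\<^sub>R (b *\<^sub>R \<xi>)"] s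
        by (simp add: \<phi>_def)
    qed
    note R = second_derivative_local_min[OF e1 e2 e3]
    have "D = m\<^sup>2 * (H z \<xi> \<bullet> \<xi>) - l * a\<^sup>2 * (H x \<xi> \<bullet> \<xi>) - (1 - l) * b\<^sup>2 * (H y \<xi> \<bullet> \<xi>)"
      unfolding D_def using xyz second_order_linear[OF v]
      by (simp add: linear_cmul power2_eq_square algebra_simps)
    with R show ?thesis unfolding \<psi>_def m_def by (simp add: algebra_simps)
  qed
  have "G x \<bullet> \<xi> = G z \<bullet> \<xi>" "G y \<bullet> \<xi> = G z \<bullet> \<xi>" for \<xi>
    using main[of 1 0 \<xi>] main[of 0 1 \<xi>] l by auto
  then show "G x = G z" "G y = G z" by (metis inner_commute vector_eq_ldot)+
  show "l * a\<^sup>2 * (H x \<xi> \<bullet> \<xi>) + (1 - l) * b\<^sup>2 * (H y \<xi> \<bullet> \<xi>) \<le> (l * a + (1 - l) * b)\<^sup>2 * (H z \<xi> \<bullet> \<xi>)"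
    using main by blast
qed

text \<open>The expression 1/(3 t^2) + 2 g/t is minus the Laplacian of the cube root where it has
  value t and squared gradient \<open>g\<close>. Kennington's condition is that its reciprocal
  \<open>f\<close> is convex; \<open>f\<close> is also increasing on the positive axis, so a bound
  on \<open>f\<close> at the mean gives a bound on the mean itself.\<close>

lemma harmonic_mean_convexity:
  fixes p q r l g :: real
  assumes "0 < p" "0 < q" "0 < r" "0 \<le> g" "0 < l" "l < 1"
    and H: "\<And>a b. (l * a + (1 - l) * b)\<^sup>2 * (1 / (3 * r\<^sup>2) + 2 * g / r)
       \<le> l * a\<^sup>2 * (1 / (3 * p\<^sup>2) + 2 * g / p) + (1 - l) * b\<^sup>2 * (1 / (3 * q\<^sup>2) + 2 * g / q)"
  shows "l * p + (1 - l) * q \<le> r"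
proof -
  define f where "f t = 3 * t\<^sup>2 / (1 + 6 * g * t)" for t
  have B: "1 / (3 * t\<^sup>2) + 2 * g / t = 1 / f t" "f t > 0" if "t > 0" for t
    using that \<open>0 \<le> g\<close> by (auto simp: f_def field_simps power2_eq_square add_pos_nonneg)
  define m where "m = l * f p + (1 - l) * f q"
  have mpos: "m > 0" unfolding m_def using B assms by (intro add_pos_pos mult_pos_pos) auto
  \<comment> \<open>The weights \<open>a = f p\<close>, \<open>b = f q\<close> minimise the
    right-hand side for a prescribed value of l a + (1 - l) b, so this is the sharpest instance of
    \<open>H\<close>.\<close>
  have "m\<^sup>2 * (1 / f r) \<le> l * (f p)\<^sup>2 * (1 / f p) + (1 - l) * (f q)\<^sup>2 * (1 / f q)"
    using H[of "f p" "f q"] assms by (simp add: B m_def)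
  also have "\<dots> = m" using B(2)[of p] B(2)[of q] assms by (simp add: m_def power2_eq_square)
  finally have "m \<le> f r" using mpos B(2)[of r] assms by (simp add: field_simps power2_eq_square)
  moreover have "f (l * p + (1 - l) * q) \<le> m"
  proof -
    have c: "convex_on {0<..} f"
    proof (rule f''_ge0_imp_convex[where f' = "\<lambda>t. (6 * t * (1 + 6 * g * t) - 18 * g * t\<^sup>2) / (1 + 6 * g * t)\<^sup>2"
          and f'' = "\<lambda>t. 6 / (1 + 6 * g * t) ^ 3"])
      fix t :: real assume t: "t \<in> {0<..}"
      have n: "1 + 6 * g * t > 0" using t \<open>0 \<le> g\<close> by (simp add: add_pos_nonneg)
      show "(f has_real_derivative (6 * t * (1 + 6 * g * t) - 18 * g * t\<^sup>2) / (1 + 6 * g * t)\<^sup>2) (at t)"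
        unfolding f_def using n
        by (auto intro!: derivative_eq_intros simp: field_simps power2_eq_square)
      show "((\<lambda>t. (6 * t * (1 + 6 * g * t) - 18 * g * t\<^sup>2) / (1 + 6 * g * t)\<^sup>2) has_real_derivative 6 / (1 + 6 * g * t) ^ 3) (at t)"
        using n by (auto intro!: derivative_eq_intros simp: divide_simps) algebra
      show "0 \<le> 6 / (1 + 6 * g * t) ^ 3" using n by simp
    qed auto
    have "f ((1 - (1 - l)) *\<^sub>R p + (1 - l) *\<^sub>R q) \<le> (1 - (1 - l)) * f p + (1 - l) * f q"
      by (rule convex_onD[OF c]) (use assms in auto)
    then show ?thesis by (simp add: m_def)
  qed
  ultimately have le: "f (l * p + (1 - l) * q) \<le> f r" by simp
  define w where "w = l * p + (1 - l) * q"
  have w: "w > 0" unfolding w_def using assms by (intro add_pos_pos mult_pos_pos) auto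
  have "3 * w\<^sup>2 * (1 + 6 * g * r) \<le> 3 * r\<^sup>2 * (1 + 6 * g * w)"
    using le w assms unfolding w_def[symmetric] f_def
    by (simp add: divide_simps add_pos_nonneg split: if_splits)
  \<comment> \<open>This is strict monotonicity of \<open>f\<close>, after clearing
    denominators.\<close>
  moreover have False if "r < w"
  proof -
    have "r\<^sup>2 < w\<^sup>2" using that assms by (simp add: power_strict_mono)
    moreover have "r\<^sup>2 * (g * w) \<le> w\<^sup>2 * (g * r)"
      using mult_right_mono[of r w "g * r * w"] that assms w by (simp add: power2_eq_square mult_ac)
    ultimately show False using \<open>3 * w\<^sup>2 * (1 + 6 * g * r) \<le> 3 * r\<^sup>2 * (1 + 6 * g * w)\<close>
      by (simp add: algebra_simps)
  qed
  ultimately show ?thesis unfolding w_def by force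
qed

lemma ball_lower_bound:
  fixes u :: "'a::euclidean_space \<Rightarrow> real"
  assumes "second_order S u G H" and tr: "\<And>x. x \<in> S \<Longrightarrow> (\<Sum>b\<in>Basis. H x b \<bullet> b) = - 1"
    and nn: "\<And>x. x \<in> S \<Longrightarrow> 0 \<le> u x" and sub: "cball z r \<subseteq> S" and r: "0 < r"
  shows "r\<^sup>2 / (4 * DIM('a)) \<le> u z"
proof -
  \<comment> \<open>The comparison function k (r^2 - |x - z|^2) is half the torsion function of the
    ball. The factor one half leaves trace -1/2 for the difference, hence the strict sign.\<close>
  define k where "k = 1 / (4 * real DIM('a))"
  have so: "second_order (ball z r) (\<lambda>x. u x - (- k) * (norm (x - z))\<^sup>2 + (- k * r\<^sup>2)) (\<lambda>x. G x - (2 * (- k)) *\<^sub>R (x - z))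
      (\<lambda>x h. H x h - (2 * (- k)) *\<^sub>R h)"
    by (intro second_order_add_const second_order_diff second_order_norm_sq second_order_subset[OF assms(1)])
       (use sub ball_subset_cball in blast)
  have "0 < u z - (- k) * (norm (z - z))\<^sup>2 + (- k * r\<^sup>2)"
  proof (rule strict_minimum_principle[OF open_ball bounded_ball so])
    have "continuous_on (cball z r) u"
      using second_order_continuous(1)[OF assms(1)] sub continuous_on_subset by blast
    then show "continuous_on (closure (ball z r)) (\<lambda>x. u x - (- k) * (norm (x - z))\<^sup>2 + (- k * r\<^sup>2))"
      using r by (auto intro!: continuous_intros)
    show "(\<Sum>b\<in>Basis. (H x b - (2 * (- k)) *\<^sub>R b) \<bullet> b) < 0" if "x \<in> ball z r" for x
    proof -
      have "x \<in> S" using that sub ball_subset_cball by blast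
      then have "(\<Sum>b\<in>Basis. (H x b - (2 * (- k)) *\<^sub>R b) \<bullet> b) = - 1 + 2 * k * DIM('a)"
        using tr by (simp add: inner_diff_left inner_add_left sum_subtractf sum.distrib)
      also have "\<dots> < 0" by (simp add: k_def)
      finally show ?thesis .
    qed
    show "0 \<le> u x - (- k) * (norm (x - z))\<^sup>2 + (- k * r\<^sup>2)" if "x \<in> frontier (ball z r)" for x
    proof -
      have "norm (x - z) = r" using that r by (simp add: dist_norm norm_minus_commute)
      moreover have "x \<in> S" using that r sub by auto
      ultimately show ?thesis using nn by simp
    qed
    show "z \<in> ball z r" using r by simp
  qed
  then show ?thesis by (simp add: k_def)
qed

section \<open>Concavity of the cube root of the torsion function\<close>

lemma open_convex_segment:
  fixes S :: "'a::euclidean_space set"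
  assumes "open S" "convex S" "x \<in> closure S" "y \<in> S" "0 < s" "s \<le> 1"
  shows "x + s *\<^sub>R (y - x) \<in> S"
  using mem_interior_closure_convex_shrink[OF assms(2), of y x s] assms
  by (simp add: interior_open algebra_simps)

locale convex_torsion =
  fixes S :: "'a::euclidean_space set" and u :: "'a \<Rightarrow> real" and G H
  assumes open_S: "open S" and convex_S: "convex S" and bounded_S: "bounded S"
    and second_order: "second_order S u G H"
    and trace: "x \<in> S \<Longrightarrow> (\<Sum>b\<in>Basis. H x b \<bullet> b) = - 1"
    and continuous: "continuous_on (closure S) u"
    and boundary: "x \<in> frontier S \<Longrightarrow> u x = 0"
begin

lemma pos: "x \<in> S \<Longrightarrow> 0 < u x"
  by (rule strict_minimum_principle[OF open_S bounded_S second_order continuous])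
     (use trace boundary in auto)

lemma closure_cases: "x \<in> closure S \<Longrightarrow> x \<in> S \<or> x \<in> frontier S"
  using open_S by (auto simp: frontier_def interior_open)

lemma nonneg: "x \<in> closure S \<Longrightarrow> 0 \<le> u x"
  using closure_cases pos boundary by (metis less_eq_real_def)

lemmas segment_in = open_convex_segment[OF open_S convex_S]

text \<open>The homothety with centre \<open>x\<close> and ratio \<open>s\<close> carries the ball
  around \<open>y\<close> to a ball of radius s r that is still in \<open>S\<close>, by convexity;
  \<open>ball_lower_bound\<close> applies there.\<close>

lemma segment_lower_bound:
  assumes "x \<in> closure S" "cball y r \<subseteq> S" "0 < r" "0 < s" "s \<le> 1"
  shows "(s * r)\<^sup>2 / (4 * DIM('a)) \<le> u (x + s *\<^sub>R (y - x))"
proof (rule ball_lower_bound[OF second_order trace])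
  show "cball (x + s *\<^sub>R (y - x)) (s * r) \<subseteq> S"
  proof
    fix p assume p: "p \<in> cball (x + s *\<^sub>R (y - x)) (s * r)"
    define q where "q = y + (1 / s) *\<^sub>R (p - (x + s *\<^sub>R (y - x)))"
    have "norm (p - (x + s *\<^sub>R (y - x))) \<le> s * r"
      using p by (simp add: dist_norm norm_minus_commute)
    moreover have "norm (q - y) = norm (p - (x + s *\<^sub>R (y - x))) / s"
      using \<open>0 < s\<close> unfolding q_def by (simp only: add_diff_cancel_left' norm_scaleR) simp
    ultimately have "q \<in> cball y r"
      using \<open>0 < s\<close> by (simp add: dist_norm norm_minus_commute[of y] divide_le_eq mult.commute)
    then have "x + s *\<^sub>R (q - x) \<in> S" using assms segment_in by blast
    moreover have "x + s *\<^sub>R (q - x) = p"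
      using \<open>0 < s\<close> by (simp add: q_def algebra_simps)
    ultimately show "p \<in> S" by simp
  qed
qed (use assms nonneg closure_subset in auto)

abbreviation v :: "'a \<Rightarrow> real" where "v x \<equiv> root 3 (u x)"

text \<open>Along a segment entering the domain \<^term>\<open>u\<close> is at least quadratic, so its cube root has
  infinite slope at the boundary, even at a vertex; the square root would have finite slope there.\<close>

lemma three_point_boundary:
  assumes x: "x \<in> frontier S" and y: "y \<in> S" and l: "0 < l" "l < 1"
  shows "\<exists>x'\<in>S. v (l *\<^sub>R x' + (1 - l) *\<^sub>R y) - l * v x' < v (l *\<^sub>R x + (1 - l) *\<^sub>R y) - l * v x"
proof -
  define z where "z = l *\<^sub>R x + (1 - l) *\<^sub>R y"
  have xc: "x \<in> closure S" using x by (simp add: frontier_def)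
  have "x + (1 - l) *\<^sub>R (y - x) \<in> S" by (rule segment_in[OF xc y]) (use l in auto)
  then have z: "z \<in> S" by (simp add: z_def algebra_simps)
  obtain r where r: "0 < r" "cball y r \<subseteq> S" using open_S y open_contains_cball by blast
  define k where "k = root 3 (r\<^sup>2 / (4 * DIM('a)))"
  have k: "0 < k" using r by (simp add: k_def)
  \<comment> \<open>When the boundary point \<open>x\<close> is moved by s (y - x), the intermediate
    point \<open>z\<close> moves by only l s (y - x); \<open>h\<close> follows \<open>v\<close>
    there, and it is differentiable because \<open>z\<close> is interior.\<close>
  define h where "h s = v (z + s *\<^sub>R (l *\<^sub>R (y - x)))" for s
  have "\<exists>L. (h has_real_derivative L) (at 0)"
    unfolding h_def
    by (rule exI, rule second_order_line(1)[OF second_order_root3[OF second_order pos]]) (use z in auto)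
  then obtain L where "(h has_real_derivative L) (at 0)" by blast
  then have "((\<lambda>s. (h s - h 0) / s) \<longlongrightarrow> L) (at 0)" by (simp add: has_field_derivative_iff)
  then have "eventually (\<lambda>s. (h s - h 0) / s < \<bar>L\<bar> + 1) (at 0)"
    by (rule order_tendstoD(2)) simp
  then obtain d where d: "d > 0" "\<And>s. s \<noteq> 0 \<Longrightarrow> \<bar>s\<bar> < d \<Longrightarrow> (h s - h 0) / s < \<bar>L\<bar> + 1"
    by (auto simp: eventually_at dist_real_def)
  \<comment> \<open>The point \<open>x\<close> is moved by the parameter t^3: \<open>u\<close> is
    then at least of order t^6, so the term \<open>l * v x'\<close> gains at least l k t^2, while
    \<open>h\<close> grows by less than (|L| + 1) t^3. The last bound on \<open>t\<close> makes the
    gain win.\<close>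
  have "0 < min (d / 2) (min 1 (l * k / (\<bar>L\<bar> + 2)))" using d(1) l k by simp
  then obtain t where "0 < t" "t \<le> min (d / 2) (min 1 (l * k / (\<bar>L\<bar> + 2)))" by blast
  then have t: "0 < t" "t \<le> d / 2" "t \<le> 1" "t \<le> l * k / (\<bar>L\<bar> + 2)" by (simp_all only: min.bounded_iff)
  have t3: "0 < t ^ 3" "t ^ 3 \<le> t" using t power_le_one[of t 2] by (auto simp: power3_eq_cube power2_eq_square mult_le_one)
  define x' where "x' = x + t ^ 3 *\<^sub>R (y - x)"
  have x': "x' \<in> S" unfolding x'_def using segment_in[OF xc y] t t3 by simp
  have "(t ^ 3 * r)\<^sup>2 / (4 * DIM('a)) \<le> u x'"
    unfolding x'_def by (rule segment_lower_bound[OF xc r(2,1)]) (use t t3 in auto)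
  then have "root 3 ((t\<^sup>2) ^ 3 * (r\<^sup>2 / (4 * DIM('a)))) \<le> v x'"
    by (simp add: power_mult_distrib flip: power_mult)
  moreover have "root 3 ((t\<^sup>2) ^ 3 * (r\<^sup>2 / (4 * DIM('a)))) = t\<^sup>2 * k"
    unfolding real_root_mult k_def using odd_real_root_power_cancel[of 3 "t\<^sup>2"] by simp
  ultimately have "t\<^sup>2 * k \<le> v x'" by metis
  moreover have "h (t ^ 3) < h 0 + (\<bar>L\<bar> + 1) * t ^ 3"
    using d(2)[of "t ^ 3"] t t3 d by (simp add: field_simps)
  moreover have "(\<bar>L\<bar> + 1) * t ^ 3 < l * (t\<^sup>2 * k)"
  proof -
    have "(\<bar>L\<bar> + 1) * t < (\<bar>L\<bar> + 2) * t" using t by simp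
    also have "\<dots> \<le> l * k" using t(4) by (simp add: field_simps)
    finally have "t\<^sup>2 * ((\<bar>L\<bar> + 1) * t) < t\<^sup>2 * (l * k)" using t by simp
    then show ?thesis by (simp add: power2_eq_square power3_eq_cube mult_ac)
  qed
  moreover have "h (t ^ 3) = v (l *\<^sub>R x' + (1 - l) *\<^sub>R y)"
    by (simp add: h_def x'_def z_def algebra_simps)
  moreover have "l * (t\<^sup>2 * k) \<le> l * v x'" using calculation(1) l by simp
  ultimately show ?thesis
    using x' boundary[OF x] by (intro bexI[of _ x']) (auto simp: h_def z_def)
qed

text \<open>With the three gradients equal, the Laplacian of \<open>v\<close> at the three points is
  one and the same function of the value of \<open>v\<close>, with a common \<open>g\<close>.
  Summing the second-order inequality over an orthonormal basis then gives the hypothesis of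
  \<open>harmonic_mean_convexity\<close>.\<close>

lemma three_point_interior:
  assumes xy: "x \<in> S" "y \<in> S" and l: "0 < l" "l < 1"
    and min: "\<And>x' y'. x' \<in> S \<Longrightarrow> y' \<in> S \<Longrightarrow>
      v (l *\<^sub>R x + (1 - l) *\<^sub>R y) - l * v x - (1 - l) * v y
       \<le> v (l *\<^sub>R x' + (1 - l) *\<^sub>R y') - l * v x' - (1 - l) * v y'"
  shows "l * v x + (1 - l) * v y \<le> v (l *\<^sub>R x + (1 - l) *\<^sub>R y)"
proof -
  define z where "z = l *\<^sub>R x + (1 - l) *\<^sub>R y"
  have z: "z \<in> S" unfolding z_def by (rule convexD[OF convex_S]) (use xy l in auto)
  define G' where "G' x = inverse (3 * (v x)\<^sup>2) *\<^sub>R G x" for x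
  define H' where "H' x h = inverse (3 * (v x)\<^sup>2) *\<^sub>R H x h - (2 / v x * (G' x \<bullet> h)) *\<^sub>R G' x" for x h
  have so: "second_order S v G' H'"
    using second_order_root3[OF second_order pos] unfolding G'_def H'_def by blast
  note T = three_point_minimum[OF so open_S xy z z_def l]
  have G': "G' x = G' z" "G' y = G' z" using T(1,2) min unfolding z_def by blast+
  define g where "g = G' z \<bullet> G' z"
  have tr: "(\<Sum>b\<in>Basis. H' p b \<bullet> b) = - (1 / (3 * (v p)\<^sup>2) + 2 * g / v p)" if "p \<in> S" "G' p = G' z" for p
  proof -
    have "(\<Sum>b\<in>Basis. H' p b \<bullet> b) = inverse (3 * (v p)\<^sup>2) * (\<Sum>b\<in>Basis. H p b \<bullet> b)
        - 2 / v p * (\<Sum>b\<in>Basis. (G' p \<bullet> b) * (G' p \<bullet> b))"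
      unfolding H'_def
      by (simp only: inner_diff_left inner_scaleR_left sum_subtractf sum_distrib_left mult.assoc)
    also have "(\<Sum>b\<in>Basis. (G' p \<bullet> b) * (G' p \<bullet> b)) = g"
      unfolding g_def that(2)[symmetric] by (rule euclidean_inner[symmetric])
    finally show ?thesis using trace[OF that(1)] by (simp add: inverse_eq_divide)
  qed
  have "l * v x + (1 - l) * v y \<le> v z"
  proof (rule harmonic_mean_convexity)
    fix a b
    have "(\<Sum>e\<in>Basis. l * a\<^sup>2 * (H' x e \<bullet> e) + (1 - l) * b\<^sup>2 * (H' y e \<bullet> e))
       \<le> (\<Sum>e\<in>Basis. (l * a + (1 - l) * b)\<^sup>2 * (H' z e \<bullet> e))"
      by (rule sum_mono) (use T(3) min in \<open>unfold z_def, blast\<close>)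
    then have "l * a\<^sup>2 * (\<Sum>e\<in>Basis. H' x e \<bullet> e) + (1 - l) * b\<^sup>2 * (\<Sum>e\<in>Basis. H' y e \<bullet> e)
       \<le> (l * a + (1 - l) * b)\<^sup>2 * (\<Sum>e\<in>Basis. H' z e \<bullet> e)"
      by (simp add: sum.distrib flip: sum_distrib_left)
    then show "(l * a + (1 - l) * b)\<^sup>2 * (1 / (3 * (v z)\<^sup>2) + 2 * g / v z)
      \<le> l * a\<^sup>2 * (1 / (3 * (v x)\<^sup>2) + 2 * g / v x) + (1 - l) * b\<^sup>2 * (1 / (3 * (v y)\<^sup>2) + 2 * g / v y)"
      using tr[OF xy(1) G'(1)] tr[OF xy(2) G'(2)] tr[OF z refl] by (simp add: algebra_simps)
  qed (use pos xy z l in \<open>auto simp: g_def\<close>)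
  then show ?thesis by (simp add: z_def)
qed

text \<open>The concavity defect \<open>f\<close> is minimised over both points and the weight on a
  compact set. At a minimiser with weight strictly between 0 and 1, exactly one boundary point is
  impossible by \<open>three_point_boundary\<close>, two interior points fall under
  \<open>three_point_interior\<close>, and two boundary points contribute zero values of
  \<open>v\<close>. Weights 0 and 1 have defect 0.\<close>

lemma cube_root_concave:
  assumes xy: "x \<in> S" "y \<in> S" and l: "0 \<le> l" "l \<le> 1"
  shows "l * v x + (1 - l) * v y \<le> v (l *\<^sub>R x + (1 - l) *\<^sub>R y)"
proof -
  define f where "f = (\<lambda>(x, y, l). v (l *\<^sub>R x + (1 - l) *\<^sub>R y) - l * v x - (1 - l) * v y)"
  let ?K = "closure S" and ?D = "closure S \<times> closure S \<times> {0..1::real}"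
  have vc: "continuous_on ?K v" by (intro continuous_intros continuous)
  have cc: "convex ?K" using convex_S by (rule convex_closure)
  have "compact ?D" using bounded_S by (intro compact_Times) (auto simp: compact_closure)
  moreover have "?D \<noteq> {}" using xy closure_subset by fastforce
  moreover have "continuous_on ?D f"
  proof -
    have im: "(\<lambda>p. snd (snd p) *\<^sub>R fst p + (1 - snd (snd p)) *\<^sub>R fst (snd p)) ` ?D \<subseteq> ?K"
      by (auto intro!: convexD[OF cc])
    have 1: "continuous_on ?D (\<lambda>p. v (snd (snd p) *\<^sub>R fst p + (1 - snd (snd p)) *\<^sub>R fst (snd p)))"
      by (rule continuous_on_compose2[OF vc _ im]) (intro continuous_intros)
    have 2: "continuous_on ?D (\<lambda>p. v (fst p))" "continuous_on ?D (\<lambda>p. v (fst (snd p)))"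
      by (rule continuous_on_compose2[OF vc]; auto intro!: continuous_intros)+
    have 3: "continuous_on ?D (\<lambda>p. snd (snd p))" by (intro continuous_intros)
    show ?thesis unfolding f_def split_beta
      by (rule continuous_on_diff[OF continuous_on_diff[OF 1 continuous_on_mult[OF 3 2(1)]]
            continuous_on_mult[OF continuous_on_diff[OF continuous_on_const 3] 2(2)]])
  qed
  ultimately have "\<exists>p\<in>?D. \<forall>q\<in>?D. f p \<le> f q" by (rule continuous_attains_inf)
  then obtain p where p: "p \<in> ?D" "\<And>q. q \<in> ?D \<Longrightarrow> f p \<le> f q" by meson
  obtain a b t where abt: "p = (a, b, t)" by (cases p)
  have ab: "a \<in> ?K" "b \<in> ?K" "0 \<le> t" "t \<le> 1" using p(1) abt by auto
  have min: "v (t *\<^sub>R a + (1 - t) *\<^sub>R b) - t * v a - (1 - t) * v b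
       \<le> v (t *\<^sub>R a' + (1 - t) *\<^sub>R b') - t * v a' - (1 - t) * v b'" if "a' \<in> ?K" "b' \<in> ?K" for a' b'
    using p(2)[of "(a', b', t)"] that ab by (simp add: abt f_def)
  have "0 \<le> f p"
  proof (cases "t = 0 \<or> t = 1")
    case True
    then show ?thesis by (auto simp: abt f_def)
  next
    case False
    then have t: "0 < t" "t < 1" using ab by auto
    have SK: "S \<subseteq> ?K" by (rule closure_subset)
    show ?thesis
    proof (cases "a \<in> S"; cases "b \<in> S")
      assume "a \<in> S" "b \<in> S"
      then have "t * v a + (1 - t) * v b \<le> v (t *\<^sub>R a + (1 - t) *\<^sub>R b)"
        by (rule three_point_interior[OF _ _ t min]) (use SK in auto)
      then show ?thesis by (simp add: abt f_def)
    next
      assume "a \<notin> S" "b \<in> S"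
      then have "a \<in> frontier S" using ab closure_cases by blast
      from three_point_boundary[OF this \<open>b \<in> S\<close> t]
      show ?thesis using min[OF _ ab(2)] SK by fastforce
    next
      assume "a \<in> S" "b \<notin> S"
      then have "b \<in> frontier S" using ab closure_cases by blast
      from three_point_boundary[OF this \<open>a \<in> S\<close>, of "1 - t"] t
      show ?thesis using min[OF ab(1)] SK by (fastforce simp: add.commute)
    next
      assume "a \<notin> S" "b \<notin> S"
      then have "u a = 0" "u b = 0" using ab closure_cases boundary by blast+
      moreover have "t *\<^sub>R a + (1 - t) *\<^sub>R b \<in> ?K" by (rule convexD[OF cc]) (use ab in auto)
      ultimately show ?thesis using nonneg by (simp add: abt f_def)
    qed
  qed
  also have "f p \<le> f (x, y, l)" using p(2) xy l closure_subset by fastforce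
  finally show ?thesis by (simp add: f_def)
qed

lemma quasiconcave:
  assumes "x \<in> S" "y \<in> S" "0 \<le> l" "l \<le> 1" "c < u x" "c < u y"
  shows "c < u (l *\<^sub>R x + (1 - l) *\<^sub>R y)"
proof -
  have "root 3 c < v x" "root 3 c < v y" using assms by auto
  then have "root 3 c < l * v x + (1 - l) * v y"
    using convex_bound_lt[of "- v x" "- root 3 c" "- v y" l "1 - l"] assms by simp
  also have "\<dots> \<le> v (l *\<^sub>R x + (1 - l) *\<^sub>R y)" using cube_root_concave assms by blast
  finally show ?thesis by simp
qed

lemma superlevel_convex: "convex {x \<in> S. c < u x}"
proof (rule convexI)
  fix x y and a b :: real assume *: "x \<in> {x \<in> S. c < u x}" "y \<in> {x \<in> S. c < u x}" "0 \<le> a" "0 \<le> b" "a + b = 1"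
  then have b: "b = 1 - a" "a \<le> 1" by auto
  have "a *\<^sub>R x + b *\<^sub>R y \<in> S" by (rule convexD[OF convex_S]) (use * in auto)
  moreover have "c < u (a *\<^sub>R x + b *\<^sub>R y)"
    unfolding b(1) by (rule quasiconcave) (use * b in auto)
  ultimately show "a *\<^sub>R x + b *\<^sub>R y \<in> {x \<in> S. c < u x}" by simp
qed

text \<open>The level line through \<^term>\<open>x\<close> is convex, so \<open>u\<^sub>\<tau>\<^sub>\<tau> = -\<kappa> \<bar>\<nabla>u\<bar> \<le> 0\<close>.\<close>

lemma tangential_second_derivative:
  assumes x: "x \<in> S" and "G x \<bullet> \<tau> = 0"
  shows "H x \<tau> \<bullet> \<tau> \<le> 0"
proof (rule ccontr)
  assume neg: "\<not> H x \<tau> \<bullet> \<tau> \<le> 0"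
  define \<phi> where "\<phi> = (\<lambda>s. u (x + s *\<^sub>R \<tau>))"
  define \<psi> where "\<psi> = (\<lambda>s. G (x + s *\<^sub>R \<tau>) \<bullet> \<tau>)"
  have \<psi>: "(\<psi> has_real_derivative H x \<tau> \<bullet> \<tau>) (at 0)"
    using second_order_line(2)[OF second_order, of x 0 \<tau>] x by (simp add: \<psi>_def)
  \<comment> \<open>A positive second derivative and a zero first derivative would give a strict
    minimum of \<open>u\<close> along the line at \<open>x\<close>. Two symmetric points then have
    larger values than their midpoint \<open>x\<close>, against quasiconcavity.\<close>
  obtain d where d: "0 < d" "\<And>h. 0 < h \<Longrightarrow> h < d \<Longrightarrow> 0 < \<psi> h"
    using DERIV_pos_inc_right[OF \<psi>] neg assms(2) by (auto simp: \<psi>_def)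
  obtain d' where d': "0 < d'" "\<And>h. 0 < h \<Longrightarrow> h < d' \<Longrightarrow> \<psi> (- h) < 0"
    using DERIV_pos_inc_left[OF \<psi>] neg assms(2) by (auto simp: \<psi>_def)
  obtain d'' where d'': "0 < d''" "\<And>s. \<bar>s\<bar> < d'' \<Longrightarrow> x + s *\<^sub>R \<tau> \<in> S"
    using eventually_line_in_open[OF open_S x, of \<tau>] by (auto simp: eventually_nhds_metric dist_real_def)
  define h where "h = min d (min d' d'') / 2"
  have h: "0 < h" "h < d" "h < d'" "h < d''" using d d' d'' by (auto simp: h_def)
  have D: "(\<phi> has_real_derivative \<psi> s) (at s)" if "\<bar>s\<bar> < d''" for s
    unfolding \<phi>_def \<psi>_def by (rule second_order_line(1)[OF second_order]) (use d'' that in auto)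
  obtain z where z: "0 < z" "z < h" "\<phi> h - \<phi> 0 = (h - 0) * \<psi> z"
    using MVT2[of 0 h \<phi> \<psi>] D h by force
  have 1: "\<phi> 0 < \<phi> h" using z d(2)[of z] h by (smt (verit) mult_pos_pos)
  obtain y where y: "- h < y" "y < 0" "\<phi> 0 - \<phi> (- h) = (0 - - h) * \<psi> y"
    using MVT2[of "- h" 0 \<phi> \<psi>] D h by force
  have "\<psi> y < 0" using d'(2)[of "- y"] y h by simp
  then have 2: "\<phi> 0 < \<phi> (- h)" using y h by (smt (verit) mult_pos_neg)
  have "u x < u ((1/2) *\<^sub>R (x + h *\<^sub>R \<tau>) + (1 - 1/2) *\<^sub>R (x + (- h) *\<^sub>R \<tau>))"
    by (rule quasiconcave) (use 1 2 d''(2)[of h] d''(2)[of "- h"] h in \<open>auto simp: \<phi>_def\<close>)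
  also have "(1/2) *\<^sub>R (x + h *\<^sub>R \<tau>) + (1 - 1/2) *\<^sub>R (x + (- h) *\<^sub>R \<tau>) = x"
    by (simp add: algebra_simps flip: scaleR_left_distrib)
  finally show False by simp
qed

end

section \<open>Gradient and superlevel sets\<close>

definition rot90 :: "real^2 \<Rightarrow> real^2" where
  "rot90 e = vector [- (e $ 2), e $ 1]"

lemma inner_real2: "(x::real^2) \<bullet> y = x $ 1 * y $ 1 + x $ 2 * y $ 2"
  by (simp add: inner_vec_def sum_2)

lemma rot90_nth [simp]: "rot90 e $ 1 = - (e $ 2)" "rot90 e $ 2 = e $ 1"
  by (simp_all add: rot90_def)

lemma rot90_inner [simp]: "rot90 e \<bullet> e = 0" "e \<bullet> rot90 e = 0" "rot90 e \<bullet> rot90 e = e \<bullet> e"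
  by (simp_all add: inner_real2 mult.commute)

lemma rot90_expand:
  assumes "e \<bullet> e = 1"
  shows "z = (z \<bullet> e) *\<^sub>R e + (z \<bullet> rot90 e) *\<^sub>R rot90 e"
proof -
  have e: "e $ 1 * e $ 1 + e $ 2 * e $ 2 = 1" using assms by (simp add: inner_real2)
  have "z $ 1 = z $ 1 * (e $ 1 * e $ 1 + e $ 2 * e $ 2)" "z $ 2 = z $ 2 * (e $ 1 * e $ 1 + e $ 2 * e $ 2)"
    unfolding e by simp_all
  then show ?thesis by (simp add: vec_eq_iff forall_2 inner_real2 algebra_simps)
qed

lemma Basis_real2: "(Basis :: (real^2) set) = {axis 1 1, axis 2 1}"
  by (auto simp: Basis_vec_def UNIV_2)

lemma rot90_trace:
  assumes "linear L" "e \<bullet> e = 1"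
  shows "L e \<bullet> e + L (rot90 e) \<bullet> rot90 e = (\<Sum>b\<in>Basis. L b \<bullet> b)"
proof -
  have e: "(e $ 1)\<^sup>2 + (e $ 2)\<^sup>2 = 1" using assms(2) by (simp add: inner_real2 power2_eq_square)
  let ?a = "axis 1 1 :: real^2" and ?b = "axis 2 1 :: real^2"
  have "L z = z $ 1 *\<^sub>R L ?a + z $ 2 *\<^sub>R L ?b" for z
  proof -
    have "z = z $ 1 *\<^sub>R ?a + z $ 2 *\<^sub>R ?b"
      by (simp add: vec_eq_iff forall_2 axis_def)
    then show ?thesis using linear_add[OF assms(1)] linear_cmul[OF assms(1)] by metis
  qed
  then have Le: "L e = e $ 1 *\<^sub>R L ?a + e $ 2 *\<^sub>R L ?b" "L (rot90 e) = - (e $ 2) *\<^sub>R L ?a + e $ 1 *\<^sub>R L ?b"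
    by (metis rot90_nth)+
  have "L e \<bullet> e + L (rot90 e) \<bullet> rot90 e = ((e $ 1)\<^sup>2 + (e $ 2)\<^sup>2) * (L ?a $ 1 + L ?b $ 2)"
    unfolding Le by (simp add: inner_real2 power2_eq_square algebra_simps)
  then show ?thesis unfolding e Basis_real2 by (simp add: inner_axis axis_eq_axis)
qed

text \<open>At a maximum of \<open>\<bar>\<nabla>u\<bar>\<^sup>2 + 3 u\<close> over \<open>{u x \<le> u \<le> c}\<close> with \<open>u < c\<close> and nonzero
  gradient, the derivative along the gradient would be positive, since \<open>u\<^sub>\<nu>\<^sub>\<nu> = -1 - u\<^sub>\<tau>\<^sub>\<tau> \<ge> -1\<close>.\<close>

lemma gradient_drop:
  fixes S :: "(real^2) set"
  assumes "convex_torsion S u G H" and y0: "y0 \<in> S" "c \<le> u y0" and c: "0 < c" and x: "x \<in> S"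
  shows "\<exists>y\<in>S. c \<le> u y \<and> (norm (G x))\<^sup>2 \<le> (norm (G y))\<^sup>2 + 3 * c"
proof -
  interpret convex_torsion S u G H by fact
  show ?thesis
  proof (cases "c \<le> u x")
    case True
    then show ?thesis using x c by (auto intro!: bexI[of _ x])
  next
    case False
    define R where "R = {p \<in> closure S. u p \<in> {u x..c}}"
    have "closed R" unfolding R_def
      using continuous_closed_preimage[OF continuous closed_closure, of "{u x..c}"]
      by (simp add: vimage_def Int_def)
    then have R: "compact R" unfolding compact_eq_bounded_closed
      using bounded_S bounded_closure bounded_subset[of "closure S" R] by (auto simp: R_def)
    \<comment> \<open>The lower bound \<open>u x > 0\<close> keeps \<open>R\<close> away from the
      frontier, where \<open>u\<close> vanishes; so a maximum over \<open>R\<close> is attained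
      where \<open>G\<close> is differentiable.\<close>
    have RS: "R \<subseteq> S" using pos[OF x] boundary closure_cases by (fastforce simp: R_def)
    have xR: "x \<in> R" using False x closure_subset by (auto simp: R_def)
    \<comment> \<open>Along the gradient direction the derivative is |Du| (2 u_\<nu>\<nu> + 3),
      which is at least |Du|. Any coefficient above 2 would serve in place of 3.\<close>
    define P where "P p = G p \<bullet> G p + 3 * u p" for p
    have "continuous_on R P" unfolding P_def
      using second_order_continuous[OF second_order] RS
      by (intro continuous_intros) (auto intro: continuous_on_subset)
    then obtain m where m: "m \<in> R" "\<And>p. p \<in> R \<Longrightarrow> P p \<le> P m"
      using continuous_attains_sup[OF R] xR by blast
    have mS: "m \<in> S" using m RS by blast
    have Px: "G x \<bullet> G x + 3 * u x \<le> G m \<bullet> G m + 3 * u m" using m(2)[OF xR] by (simp add: P_def)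
    consider "u m = c" | "u m < c" "G m = 0" | "u m < c" "G m \<noteq> 0" using m(1) by (force simp: R_def)
    then show ?thesis
    proof cases
      case 1
      then show ?thesis using Px mS pos[OF x] by (auto simp: power2_norm_eq_inner intro!: bexI[of _ m])
    next
      case 2
      then have "G x \<bullet> G x \<le> 3 * c" using Px pos[OF x] by simp
      then show ?thesis using y0 by (auto simp: power2_norm_eq_inner intro!: bexI[of _ y0] add_increasing)
    next
      case 3
      define \<nu> where "\<nu> = (1 / norm (G m)) *\<^sub>R G m"
      have \<nu>: "\<nu> \<bullet> \<nu> = 1" "G m = norm (G m) *\<^sub>R \<nu>" "0 < norm (G m)"
        using 3(2) by (simp_all add: \<nu>_def power2_norm_eq_inner[symmetric] power2_eq_square)
      have "G m \<bullet> rot90 \<nu> = 0" by (subst \<nu>(2)) simp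
      then have "H m (rot90 \<nu>) \<bullet> rot90 \<nu> \<le> 0" by (rule tangential_second_derivative[OF mS])
      moreover have "linear (H m)" using second_order_linear[OF second_order mS] .
      ultimately have "- 1 \<le> H m \<nu> \<bullet> \<nu>" using rot90_trace[of "H m" \<nu>] \<nu>(1) trace[OF mS] by simp
      have G: "((\<lambda>s. G (m + s *\<^sub>R \<nu>)) has_derivative (\<lambda>s. H m (s *\<^sub>R \<nu>))) (at 0)"
      proof -
        have 1: "((\<lambda>s::real. m + s *\<^sub>R \<nu>) has_derivative (\<lambda>s. s *\<^sub>R \<nu>)) (at 0)"
          by (auto intro!: derivative_eq_intros)
        have 2: "(G has_derivative H m) (at (m + 0 *\<^sub>R \<nu>))"
          using second_order mS by (simp add: second_order_def)
        show ?thesis by (rule has_derivative_compose[OF 1 2])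
      qed
      have "G m \<bullet> \<nu> = norm (G m)" by (subst \<nu>(2)) (simp add: \<nu>(1))
      then have u: "((\<lambda>s. u (m + s *\<^sub>R \<nu>)) has_real_derivative norm (G m)) (at 0)"
        using second_order_line(1)[OF second_order, of m 0 \<nu>] mS by simp
      have P: "((\<lambda>s. P (m + s *\<^sub>R \<nu>)) has_real_derivative norm (G m) * (2 * (H m \<nu> \<bullet> \<nu>) + 3)) (at 0)"
      proof -
        have "((\<lambda>s. G (m + s *\<^sub>R \<nu>) \<bullet> G (m + s *\<^sub>R \<nu>)) has_derivative
            (\<lambda>s. G (m + 0 *\<^sub>R \<nu>) \<bullet> H m (s *\<^sub>R \<nu>) + H m (s *\<^sub>R \<nu>) \<bullet> G (m + 0 *\<^sub>R \<nu>))) (at 0)"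
          by (rule has_derivative_inner[OF G G])
        also have "(\<lambda>s. G (m + 0 *\<^sub>R \<nu>) \<bullet> H m (s *\<^sub>R \<nu>) + H m (s *\<^sub>R \<nu>) \<bullet> G (m + 0 *\<^sub>R \<nu>))
            = (*) (2 * norm (G m) * (H m \<nu> \<bullet> \<nu>))"
        proof
          fix s
          have "G m \<bullet> H m (s *\<^sub>R \<nu>) = s * norm (G m) * (H m \<nu> \<bullet> \<nu>)"
            by (subst \<nu>(2)) (simp add: linear_cmul[OF \<open>linear (H m)\<close>] inner_commute)
          then show "G (m + 0 *\<^sub>R \<nu>) \<bullet> H m (s *\<^sub>R \<nu>) + H m (s *\<^sub>R \<nu>) \<bullet> G (m + 0 *\<^sub>R \<nu>) = 2 * norm (G m) * (H m \<nu> \<bullet> \<nu>) * s"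
            by (simp add: inner_commute)
        qed
        finally have "((\<lambda>s. G (m + s *\<^sub>R \<nu>) \<bullet> G (m + s *\<^sub>R \<nu>)) has_real_derivative 2 * norm (G m) * (H m \<nu> \<bullet> \<nu>)) (at 0)"
          by (simp add: has_field_derivative_def)
        from DERIV_add[OF this DERIV_cmult[OF u, of 3]] show ?thesis
          by (simp add: P_def algebra_simps)
      qed
      have "0 < norm (G m) * (2 * (H m \<nu> \<bullet> \<nu>) + 3)"
        using \<open>- 1 \<le> H m \<nu> \<bullet> \<nu>\<close> \<nu>(3) by simp
      then obtain d1 where d1: "0 < d1" "\<And>h. 0 < h \<Longrightarrow> h < d1 \<Longrightarrow> P m < P (m + h *\<^sub>R \<nu>)"
        using DERIV_pos_inc_right[OF P] by auto
      obtain d2 where d2: "0 < d2" "\<And>h. 0 < h \<Longrightarrow> h < d2 \<Longrightarrow> u m < u (m + h *\<^sub>R \<nu>)"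
        using DERIV_pos_inc_right[OF u] \<nu>(3) by auto
      have "open {p \<in> S. u p < c}"
        using continuous_open_preimage[OF second_order_continuous(1)[OF second_order] open_S, of "{..<c}"]
        by (simp add: vimage_def Int_def)
      from eventually_line_in_open[OF this, of m \<nu>] mS 3(1)
      obtain d3 where d3: "0 < d3" "\<And>h. \<bar>h\<bar> < d3 \<Longrightarrow> m + h *\<^sub>R \<nu> \<in> S \<and> u (m + h *\<^sub>R \<nu>) < c"
        by (auto simp: eventually_nhds_metric dist_real_def)
      define h where "h = min d1 (min d2 d3) / 2"
      have h: "0 < h" "h < d1" "h < d2" "h < d3" using d1 d2 d3 by (auto simp: h_def)
      \<comment> \<open>Along the gradient \<open>u\<close> increases, so the lower constraint of
        \<open>R\<close> persists; the upper one is not active at \<open>m\<close>. The step thus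
        stays in \<open>R\<close> and contradicts maximality.\<close>
      have "m + h *\<^sub>R \<nu> \<in> R"
        using d2(2)[of h] d3(2)[of h] h m(1) closure_subset by (fastforce simp: R_def)
      then have False using m(2) d1(2)[of h] h by fastforce
      then show ?thesis ..
    qed
  qed
qed

section \<open>From the defined gradient and Laplacian to the analytic setting\<close>

lemma grad_eqI:
  assumes "(f has_derivative (\<lambda>h. D \<bullet> h)) (at x)"
  shows "grad f x = D"
proof -
  have D: "GDERIV f x :> D" using assms by (simp add: gderiv_def inner_commute)
  moreover have "D' = D" if "GDERIV f x :> D'" for D'
  proof -
    have "(\<lambda>h. h \<bullet> D') = (\<lambda>h. h \<bullet> D)"
      using has_derivative_unique that D unfolding gderiv_def by blast
    then show ?thesis by (metis vector_eq_ldot)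
  qed
  ultimately show ?thesis unfolding grad_def by blast
qed

lemma has_derivative_grad:
  assumes "f differentiable (at x)"
  shows "(f has_derivative (\<lambda>h. grad f x \<bullet> h)) (at x)"
proof -
  obtain f' where f': "(f has_derivative f') (at x)" using assms unfolding differentiable_def by blast
  define D where "D = (\<Sum>b\<in>Basis. f' b *\<^sub>R b)"
  have lin: "linear f'" using f' has_derivative_linear by blast
  have "f' = (\<lambda>h. D \<bullet> h)"
  proof
    fix h
    have "f' h = f' (\<Sum>b\<in>Basis. (h \<bullet> b) *\<^sub>R b)" by (simp add: euclidean_representation)
    also have "\<dots> = (\<Sum>b\<in>Basis. (h \<bullet> b) * f' b)" by (simp add: linear_sum[OF lin] linear_cmul[OF lin])
    finally show "f' h = D \<bullet> h" unfolding D_def inner_sum_left by (auto intro!: sum.cong simp: inner_commute)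
  qed
  then show ?thesis using f' grad_eqI by metis
qed

text \<open>The admissible gradient vectors of both functions coincide at every point, including
  points without any, so the definite descriptions agree everywhere.\<close>

lemma grad_diff_const: "grad (\<lambda>x. u x - c) = grad u"
proof -
  have "GDERIV (\<lambda>x. u x - c) x :> D \<longleftrightarrow> GDERIV u x :> D" for x D
    unfolding gderiv_def
    using has_derivative_add_const[of u "\<lambda>h. h \<bullet> D" "at x" "- c"]
      has_derivative_add_const[of "\<lambda>x. u x - c" "\<lambda>h. h \<bullet> D" "at x" c] by auto
  then show ?thesis unfolding grad_def by presburger
qed

lemma torsion_function_convex_torsion:
  assumes "bounded_convex_domain \<Omega>" "torsion_function \<Omega> u"
  shows "convex_torsion \<Omega> u (grad u) (\<lambda>x. frechet_derivative (grad u) (at x))"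
proof
  show "second_order \<Omega> u (grad u) (\<lambda>x. frechet_derivative (grad u) (at x))"
    using assms(2) unfolding torsion_function_def C2_on_def second_order_def
    by (simp add: has_derivative_grad flip: frechet_derivative_works)
qed (use assms in \<open>auto simp: bounded_convex_domain_def torsion_function_def laplacian_def\<close>)

text \<open>On the closure of the superlevel set \<open>u\<close> is at least \<open>c > 0\<close>,
  so this closure avoids the frontier of the domain. A frontier point therefore lies in the domain,
  and there \<open>u\<close> equals \<open>c\<close>.\<close>

lemma superlevel_torsion:
  assumes "bounded_convex_domain \<Omega>" "torsion_function \<Omega> u" and c: "0 < c" "{x \<in> \<Omega>. c < u x} \<noteq> {}"
  shows "bounded_convex_domain {x \<in> \<Omega>. c < u x}" "torsion_function {x \<in> \<Omega>. c < u x} (\<lambda>x. u x - c)"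
proof -
  interpret convex_torsion \<Omega> u "grad u" "\<lambda>x. frechet_derivative (grad u) (at x)"
    by (rule torsion_function_convex_torsion) fact+
  let ?A = "{x \<in> \<Omega>. c < u x}"
  have op: "open ?A"
    using continuous_open_preimage[OF second_order_continuous(1)[OF second_order] open_S, of "{c<..}"]
    by (simp add: vimage_def Int_def)
  show "bounded_convex_domain ?A"
    unfolding bounded_convex_domain_def
    using op superlevel_convex c bounded_subset[OF bounded_S] by auto
  have clA: "closure ?A \<subseteq> closure \<Omega>" by (rule closure_mono) auto
  have ge: "c \<le> u x" if "x \<in> closure ?A" for x
    using continuous_ge_on_closure[OF continuous_on_subset[OF continuous clA] that] by auto
  have fr: "u x = c" if "x \<in> frontier ?A" for x
  proof -
    have x: "x \<in> closure ?A" "x \<notin> ?A" using that op by (auto simp: frontier_def interior_open)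
    then have "x \<in> \<Omega>" using ge[OF x(1)] clA closure_cases boundary c(1) by force
    then show ?thesis using x ge[OF x(1)] by auto
  qed
  show "torsion_function ?A (\<lambda>x. u x - c)"
    unfolding torsion_function_def
  proof (intro conjI ballI)
    show "continuous_on (closure ?A) (\<lambda>x. u x - c)"
      by (intro continuous_intros continuous_on_subset[OF continuous clA])
    show "C2_on ?A (\<lambda>x. u x - c)"
      using assms(2) unfolding torsion_function_def C2_on_def grad_diff_const
      by (auto intro: continuous_on_subset)
    show "- laplacian (\<lambda>x. u x - c) x = 1" if "x \<in> ?A" for x
      using that assms(2) by (simp add: laplacian_def grad_diff_const torsion_function_def)
    show "u x - c = 0" if "x \<in> frontier ?A" for x using fr[OF that] by simp
  qed
qed

section \<open>Geometry of a corner\<close>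

lemma arc_tangent:
  assumes "C1_holder_arc s \<gamma>"
  shows "((\<lambda>t. (1 / t) *\<^sub>R (\<gamma> t - \<gamma> 0)) \<longlongrightarrow> velocity \<gamma> 0) (at_right 0)"
proof -
  have "(\<gamma> has_vector_derivative velocity \<gamma> 0) (at 0 within {0..1})"
    using assms unfolding C1_holder_arc_def by (simp add: vector_derivative_works[symmetric])
  then have "((\<lambda>y. (1 / norm (y - 0)) *\<^sub>R (\<gamma> y - (\<gamma> 0 + (y - 0) *\<^sub>R velocity \<gamma> 0))) \<longlongrightarrow> 0) (at_right 0)"
    unfolding has_vector_derivative_def has_derivative_within
    by (simp add: at_within_Icc_at_right)
  then have "((\<lambda>t. (1 / t) *\<^sub>R (\<gamma> t - \<gamma> 0) - velocity \<gamma> 0) \<longlongrightarrow> 0) (at_right 0)"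
    by (rule Lim_transform_eventually)
      (auto simp: eventually_at_right_field algebra_simps intro!: exI[of _ 1])
  then show ?thesis by (simp add: LIM_zero_iff)
qed

lemma arc_tangent_inner:
  assumes "C1_holder_arc s \<gamma>"
  shows "((\<lambda>t. ((\<gamma> t - \<gamma> 0) \<bullet> m) / t) \<longlongrightarrow> velocity \<gamma> 0 \<bullet> m) (at_right 0)"
  using tendsto_inner[OF arc_tangent[OF assms] tendsto_const[of m]] by simp

lemma eventually_at_right_unit:
  fixes P :: "real \<Rightarrow> bool"
  assumes "eventually P (at_right 0)"
  obtains d where "0 < d" "d \<le> 1" "\<And>t. 0 < t \<Longrightarrow> t \<le> d \<Longrightarrow> P t"
proof -
  obtain b where b: "0 < b" "\<And>t. 0 < t \<Longrightarrow> t < b \<Longrightarrow> P t"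
    using assms by (auto simp: eventually_at_right_field)
  show ?thesis by (rule that[of "min (b / 2) 1"]) (use b in auto)
qed

text \<open>The tangent line is a supporting line. A tangent point in the open domain would be a
  limit of points on secants through the vertex, which are then in the domain too. By convexity such
  a secant point would pull into the domain either a point of the arc (for x > 0) or the vertex (for
  x < 0).\<close>

lemma tangent_line_avoids:
  assumes \<Omega>: "open \<Omega>" "convex \<Omega>" and \<gamma>: "C1_holder_arc s \<gamma>" "path_image \<gamma> \<subseteq> frontier \<Omega>"
  shows "\<gamma> 0 + x *\<^sub>R velocity \<gamma> 0 \<notin> \<Omega>"
proof
  assume in\<Omega>: "\<gamma> 0 + x *\<^sub>R velocity \<gamma> 0 \<in> \<Omega>"
  have "\<gamma> t \<in> frontier \<Omega>" if "0 \<le> t" "t \<le> 1" for t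
    using that \<gamma>(2) by (auto simp: path_image_def)
  then have fr: "\<gamma> t \<in> closure \<Omega>" "\<gamma> t \<notin> \<Omega>" if "0 \<le> t" "t \<le> 1" for t
    using that \<Omega>(1) by (auto simp: frontier_def interior_open)
  have "((\<lambda>t. \<gamma> 0 + x *\<^sub>R ((1 / t) *\<^sub>R (\<gamma> t - \<gamma> 0))) \<longlongrightarrow> \<gamma> 0 + x *\<^sub>R velocity \<gamma> 0) (at_right 0)"
    by (intro tendsto_intros arc_tangent[OF \<gamma>(1)])
  then have "eventually (\<lambda>t. \<gamma> 0 + x *\<^sub>R ((1 / t) *\<^sub>R (\<gamma> t - \<gamma> 0)) \<in> \<Omega>) (at_right 0)"
    using \<Omega>(1) in\<Omega> topological_tendstoD by blast
  then obtain d where d: "0 < d" "d \<le> 1"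
      "\<And>t. 0 < t \<Longrightarrow> t \<le> d \<Longrightarrow> \<gamma> 0 + x *\<^sub>R ((1 / t) *\<^sub>R (\<gamma> t - \<gamma> 0)) \<in> \<Omega>"
    by (rule eventually_at_right_unit) blast
  consider "x = 0" | "0 < x" | "x < 0" by linarith
  then show False
  proof cases
    case 1
    then show ?thesis using in\<Omega> fr[of 0] by simp
  next
    case 2
    define t where "t = min d x"
    have t: "0 < t" "t \<le> d" "t \<le> x" using d 2 by (auto simp: t_def)
    have "\<gamma> 0 + (t / x) *\<^sub>R ((\<gamma> 0 + x *\<^sub>R ((1 / t) *\<^sub>R (\<gamma> t - \<gamma> 0))) - \<gamma> 0) \<in> \<Omega>"
      by (rule open_convex_segment[OF \<Omega> fr(1) d(3)]) (use t 2 in auto)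
    also have "\<gamma> 0 + (t / x) *\<^sub>R ((\<gamma> 0 + x *\<^sub>R ((1 / t) *\<^sub>R (\<gamma> t - \<gamma> 0))) - \<gamma> 0) = \<gamma> t"
      using t 2 by simp
    finally show ?thesis using fr[of t] t d by simp
  next
    case 3
    \<comment> \<open>For x < 0 the vertex lies between the arc point and the secant point, and
      \<open>r\<close> is its parameter on that segment.\<close>
    define r where "r = 1 / (1 - x / d)"
    have xd: "x / d < 0" using 3 d by (simp add: divide_neg_pos)
    have r: "0 < r" "r \<le> 1" "r * (1 - x / d) = 1" unfolding r_def using xd by auto
    have "\<gamma> d + r *\<^sub>R ((\<gamma> 0 + x *\<^sub>R ((1 / d) *\<^sub>R (\<gamma> d - \<gamma> 0))) - \<gamma> d) \<in> \<Omega>"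
      by (rule open_convex_segment[OF \<Omega> fr(1) d(3)]) (use r d in auto)
    also have "\<gamma> d + r *\<^sub>R ((\<gamma> 0 + x *\<^sub>R ((1 / d) *\<^sub>R (\<gamma> d - \<gamma> 0))) - \<gamma> d)
       = \<gamma> d - (r * (1 - x / d)) *\<^sub>R (\<gamma> d - \<gamma> 0)"
      by (simp add: algebra_simps)
    finally show ?thesis using fr[of 0] unfolding r(3) by simp
  qed
qed

lemma convex_inner_sign:
  fixes S :: "'a::real_inner set"
  assumes "convex S" "\<And>w. w \<in> S \<Longrightarrow> (w - V) \<bullet> m \<noteq> 0"
  shows "(\<forall>w\<in>S. 0 < (w - V) \<bullet> m) \<or> (\<forall>w\<in>S. (w - V) \<bullet> m < 0)"
proof (rule ccontr)
  assume "\<not> ?thesis"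
  then obtain w w' where w: "w \<in> S" "0 < (w - V) \<bullet> m" "w' \<in> S" "(w' - V) \<bullet> m < 0"
    using assms(2) by (meson linorder_neqE_linordered_idom)
  define p q where "p = (w - V) \<bullet> m" and "q = (w' - V) \<bullet> m"
  have pq: "0 < p" "q < 0" using w by (auto simp: p_def q_def)
  define t where "t = p / (p - q)"
  have t: "0 \<le> t" "t \<le> 1" "(1 - t) * p + t * q = 0" using pq by (auto simp: t_def field_simps)
  have "(1 - t) *\<^sub>R w + t *\<^sub>R w' \<in> S" by (rule convexD[OF assms(1) w(1,3)]) (use t in auto)
  moreover have "(1 - t) *\<^sub>R w + t *\<^sub>R w' - V = (1 - t) *\<^sub>R (w - V) + t *\<^sub>R (w' - V)"
    by (simp add: algebra_simps)
  then have "((1 - t) *\<^sub>R w + t *\<^sub>R w' - V) \<bullet> m = (1 - t) * p + t * q"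
    by (simp add: p_def q_def inner_add_left)
  ultimately show False using assms(2) t(3) by metis
qed

lemma closure_inner_nonneg:
  fixes S :: "'a::real_inner set"
  assumes "\<And>w. w \<in> S \<Longrightarrow> 0 \<le> (w - V) \<bullet> m" "w \<in> closure S"
  shows "0 \<le> (w - V) \<bullet> m"
proof (rule continuous_ge_on_closure[OF _ assms(2)])
  show "continuous_on (closure S) (\<lambda>w. (w - V) \<bullet> m)" by (intro continuous_intros)
qed (use assms in auto)

lemma velocity_inner_nonneg:
  assumes "C1_holder_arc s \<gamma>" "path_image \<gamma> \<subseteq> closure S" "\<And>w. w \<in> S \<Longrightarrow> 0 \<le> (w - \<gamma> 0) \<bullet> m"
  shows "0 \<le> velocity \<gamma> 0 \<bullet> m"
proof (rule tendsto_lowerbound[OF arc_tangent_inner[OF assms(1)]])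
  have "0 \<le> ((\<gamma> t - \<gamma> 0) \<bullet> m) / t" if "0 < t" "t < 1" for t
  proof -
    have "\<gamma> t \<in> closure S" using assms(2) that by (auto simp: path_image_def)
    then have "0 \<le> (\<gamma> t - \<gamma> 0) \<bullet> m" by (rule closure_inner_nonneg[rotated]) (rule assms(3))
    then show ?thesis using that by simp
  qed
  then show "\<forall>\<^sub>F t in at_right 0. 0 \<le> ((\<gamma> t - \<gamma> 0) \<bullet> m) / t"
    by (auto simp: eventually_at_right_field intro!: exI[of _ 1])
qed simp

lemma arc_slope:
  assumes "C1_holder_arc s \<gamma>" "0 < velocity \<gamma> 0 \<bullet> e" "velocity \<gamma> 0 \<bullet> n = 0" "0 < k"
  shows "eventually (\<lambda>t. 0 < (\<gamma> t - \<gamma> 0) \<bullet> e \<and> \<bar>(\<gamma> t - \<gamma> 0) \<bullet> n\<bar> < k * ((\<gamma> t - \<gamma> 0) \<bullet> e)) (at_right 0)"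
proof -
  have "((\<lambda>t. k * (((\<gamma> t - \<gamma> 0) \<bullet> e) / t) - \<bar>((\<gamma> t - \<gamma> 0) \<bullet> n) / t\<bar>) \<longlongrightarrow> k * (velocity \<gamma> 0 \<bullet> e) - \<bar>velocity \<gamma> 0 \<bullet> n\<bar>) (at_right 0)"
    by (intro tendsto_intros arc_tangent_inner[OF assms(1)])
  then have "eventually (\<lambda>t. 0 < k * (((\<gamma> t - \<gamma> 0) \<bullet> e) / t) - \<bar>((\<gamma> t - \<gamma> 0) \<bullet> n) / t\<bar>) (at_right 0)"
    by (rule order_tendstoD(1)) (use assms in simp)
  moreover have "eventually (\<lambda>t. 0 < ((\<gamma> t - \<gamma> 0) \<bullet> e) / t) (at_right 0)"
    by (rule order_tendstoD(1)[OF arc_tangent_inner[OF assms(1)] assms(2)])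
  moreover have "eventually (\<lambda>t. 0 < t) (at_right (0::real))" by (simp add: eventually_at_right_less)
  ultimately show ?thesis
    by eventually_elim (auto simp: field_simps)
qed

text \<open>The product inequalities say that \<open>p\<close> and \<open>q\<close> lie strictly
  below the segment from \<open>V\<close> to \<open>w\<close>. If they were distinct on one
  vertical, the upper one would lie between a closure point and an interior point on that segment,
  hence in the domain.\<close>

lemma frontier_graph_unique:
  fixes \<Omega> :: "(real^2) set"
  assumes \<Omega>: "open \<Omega>" "convex \<Omega>"
    and frame: "\<And>z. z = (z \<bullet> e) *\<^sub>R e + (z \<bullet> n) *\<^sub>R n"
    and V: "V \<in> closure \<Omega>" and w: "w \<in> \<Omega>" "x \<le> (w - V) \<bullet> e"
    and p: "p \<in> frontier \<Omega>" "(p - V) \<bullet> e = x" "(p - V) \<bullet> n * ((w - V) \<bullet> e) < (w - V) \<bullet> n * x"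
    and q: "q \<in> frontier \<Omega>" "(q - V) \<bullet> e = x" "(q - V) \<bullet> n * ((w - V) \<bullet> e) < (w - V) \<bullet> n * x"
    and x: "0 < x"
  shows "p = q"
proof -
  have less: False if p: "p \<in> frontier \<Omega>" "(p - V) \<bullet> e = x" 
    and q: "q \<in> frontier \<Omega>" "(q - V) \<bullet> e = x" "(q - V) \<bullet> n * ((w - V) \<bullet> e) < (w - V) \<bullet> n * x"
    and lt: "(p - V) \<bullet> n < (q - V) \<bullet> n" for p q
  proof -
    define r where "r = V + (x / ((w - V) \<bullet> e)) *\<^sub>R (w - V)"
    have X0: "0 < (w - V) \<bullet> e" using w x by simp
    have r: "r \<in> \<Omega>" unfolding r_def by (rule open_convex_segment[OF \<Omega> V w(1)]) (use x w in auto)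
    have rc: "(r - V) \<bullet> e = x" "(r - V) \<bullet> n = x * ((w - V) \<bullet> n) / ((w - V) \<bullet> e)" using X0 by (auto simp: r_def)
    define P Q R where "P = (p - V) \<bullet> n" and "Q = (q - V) \<bullet> n" and "R = (r - V) \<bullet> n"
    have PQR: "P < Q" "Q < R" using lt q(3) X0 by (auto simp: P_def Q_def R_def rc field_simps)
    define s where "s = (Q - P) / (R - P)"
    have s: "0 < s" "s \<le> 1" "s * (R - P) = Q - P" using PQR by (auto simp: s_def)
    have "p + s *\<^sub>R (r - p) \<in> \<Omega>"
      by (rule open_convex_segment[OF \<Omega> _ r s(1,2)]) (use p in \<open>simp add: frontier_def\<close>)
    moreover have "p + s *\<^sub>R (r - p) = q"
    proof -
      have "(p + s *\<^sub>R (r - p) - q) \<bullet> e = 0"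
        using p(2) q(2) rc(1) by (simp add: algebra_simps)
      moreover have "(p + s *\<^sub>R (r - p) - q) \<bullet> n = 0"
        using s(3) unfolding P_def Q_def R_def by (simp add: algebra_simps)
      ultimately show ?thesis using frame[of "p + s *\<^sub>R (r - p) - q"] by simp
    qed
    ultimately show False using q(1) \<Omega>(1) by (simp add: frontier_def interior_open)
  qed
  have "(p - V) \<bullet> n = (q - V) \<bullet> n"
    using less[OF p(1,2) q] less[OF q(1,2) p] by (meson linorder_neqE_linordered_idom)
  then have "(p - q) \<bullet> e = 0" "(p - q) \<bullet> n = 0" using p(2) q(2) by (simp_all add: inner_diff_left)
  then show ?thesis using frame[of "p - q"] by simp
qed

text \<open>This rules out a corner of angle 0. Near the vertex both arcs run below the segment from
  \<open>V\<close> to an interior point, of slope \<open>k > 0\<close>, because their slope tends to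
  0. By the intermediate value theorem both reach a common abscissa, where the frontier has only one
  point below the segment.\<close>

lemma tangent_arcs_meet:
  assumes \<Omega>: "open \<Omega>" "convex \<Omega>"
    and frame: "\<And>z. z = (z \<bullet> e) *\<^sub>R e + (z \<bullet> n) *\<^sub>R n"
    and pos: "\<And>w. w \<in> \<Omega> \<Longrightarrow> 0 < (w - V) \<bullet> n"
    and \<gamma>: "C1_holder_arc s \<gamma>" "path_image \<gamma> \<subseteq> frontier \<Omega>" "\<gamma> 0 = V"
      "0 < velocity \<gamma> 0 \<bullet> e" "velocity \<gamma> 0 \<bullet> n = 0"
    and \<gamma>': "C1_holder_arc s \<gamma>'" "path_image \<gamma>' \<subseteq> frontier \<Omega>" "\<gamma>' 0 = V"
      "0 < velocity \<gamma>' 0 \<bullet> e" "velocity \<gamma>' 0 \<bullet> n = 0"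
  shows "path_image \<gamma> \<inter> path_image \<gamma>' \<noteq> {V}"
proof -
  have fr: "\<gamma> t \<in> frontier \<Omega>" "\<gamma>' t \<in> frontier \<Omega>" if "0 \<le> t" "t \<le> 1" for t
    using that \<gamma>(2) \<gamma>'(2) by (auto simp: path_image_def)
  have V: "V \<in> closure \<Omega>" using fr(1)[of 0] \<gamma>(3) by (simp add: frontier_def)
  obtain w where w: "w \<in> \<Omega>" "0 < (w - V) \<bullet> e"
  proof -
    obtain d where d: "0 < d" "d \<le> 1" "\<And>t. 0 < t \<Longrightarrow> t \<le> d \<Longrightarrow> 0 < (\<gamma> t - \<gamma> 0) \<bullet> e \<and> \<bar>(\<gamma> t - \<gamma> 0) \<bullet> n\<bar> < 1 * ((\<gamma> t - \<gamma> 0) \<bullet> e)"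
      by (rule eventually_at_right_unit[OF arc_slope[OF \<gamma>(1,4,5), of 1]]) auto
    have "\<gamma> d \<in> closure \<Omega>" using fr(1)[of d] d by (simp add: frontier_def)
    moreover have "open ((\<lambda>z. (z - V) \<bullet> e) -` {0<..})"
      by (intro open_vimage continuous_intros open_greaterThan)
    moreover have "\<gamma> d \<in> (\<lambda>z. (z - V) \<bullet> e) -` {0<..}" using d \<gamma>(3) by simp
    ultimately have "(\<lambda>z. (z - V) \<bullet> e) -` {0<..} \<inter> \<Omega> \<noteq> {}"
      using open_Int_closure_eq_empty by blast
    then show ?thesis using that by auto
  qed
  define k where "k = ((w - V) \<bullet> n) / ((w - V) \<bullet> e)"
  have k: "0 < k" using pos[OF w(1)] w(2) by (simp add: k_def)
  obtain d where d: "0 < d" "d \<le> 1" "\<And>t. 0 < t \<Longrightarrow> t \<le> d \<Longrightarrow> 0 < (\<gamma> t - \<gamma> 0) \<bullet> e \<and> \<bar>(\<gamma> t - \<gamma> 0) \<bullet> n\<bar> < k * ((\<gamma> t - \<gamma> 0) \<bullet> e)"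
    by (rule eventually_at_right_unit[OF arc_slope[OF \<gamma>(1,4,5) k]]) auto
  obtain d' where d': "0 < d'" "d' \<le> 1" "\<And>t. 0 < t \<Longrightarrow> t \<le> d' \<Longrightarrow> 0 < (\<gamma>' t - \<gamma>' 0) \<bullet> e \<and> \<bar>(\<gamma>' t - \<gamma>' 0) \<bullet> n\<bar> < k * ((\<gamma>' t - \<gamma>' 0) \<bullet> e)"
    by (rule eventually_at_right_unit[OF arc_slope[OF \<gamma>'(1,4,5) k]]) auto
  define x where "x = min ((w - V) \<bullet> e) (min ((\<gamma> d - V) \<bullet> e) ((\<gamma>' d' - V) \<bullet> e))"
  have x: "0 < x" "x \<le> (w - V) \<bullet> e" "x \<le> (\<gamma> d - V) \<bullet> e" "x \<le> (\<gamma>' d' - V) \<bullet> e"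
    using w(2) d(3)[of d] d'(3)[of d'] d(1) d'(1) \<gamma>(3) \<gamma>'(3) by (auto simp: x_def)
  have cont: "continuous_on {0..1} \<gamma>" "continuous_on {0..1} \<gamma>'"
    using \<gamma>(1) \<gamma>'(1) by (auto simp: C1_holder_arc_def arc_def path_def)
  have "\<exists>t\<ge>0. t \<le> d \<and> (\<gamma> t - V) \<bullet> e = x"
    by (rule IVT') (use x d(1,2) \<gamma>(3) in \<open>auto intro!: continuous_intros continuous_on_subset[OF cont(1)]\<close>)
  then obtain t where t: "0 \<le> t" "t \<le> d" "(\<gamma> t - V) \<bullet> e = x" by blast
  have "\<exists>t\<ge>0. t \<le> d' \<and> (\<gamma>' t - V) \<bullet> e = x"
    by (rule IVT') (use x d'(1,2) \<gamma>'(3) in \<open>auto intro!: continuous_intros continuous_on_subset[OF cont(2)]\<close>)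
  then obtain t' where t': "0 \<le> t'" "t' \<le> d'" "(\<gamma>' t' - V) \<bullet> e = x" by blast
  have "t \<noteq> 0" "t' \<noteq> 0" using t(3) t'(3) x(1) \<gamma>(3) \<gamma>'(3) by auto
  then have "(\<gamma> t - V) \<bullet> n < k * x" "(\<gamma>' t' - V) \<bullet> n < k * x"
    using d(3)[of t] d'(3)[of t'] t t' \<gamma>(3) \<gamma>'(3) by auto
  then have "(\<gamma> t - V) \<bullet> n * ((w - V) \<bullet> e) < (w - V) \<bullet> n * x"
     "(\<gamma>' t' - V) \<bullet> n * ((w - V) \<bullet> e) < (w - V) \<bullet> n * x"
    using w(2) by (simp_all add: k_def field_simps)
  then have "\<gamma> t = \<gamma>' t'"
    using frontier_graph_unique[OF \<Omega> frame V w(1) x(2) fr(1) t(3) _ fr(2) t'(3) _ x(1)] t t' d(2) d'(2) by auto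
  then have "\<gamma> t \<in> path_image \<gamma> \<inter> path_image \<gamma>'"
    using t t' d(2) d'(2) by (auto simp: path_image_def intro!: imageI) (metis atLeastAtMost_iff imageI order_trans)
  moreover have "\<gamma> t \<noteq> V" using t(3) x(1) by auto
  ultimately show ?thesis by blast
qed

text \<open>Here \<open>e\<close> is tangent to the first arc, \<open>n\<close> is the inner normal
  there, \<open>a\<close> is the slope of the second tangent and \<open>b\<close> the slope of some
  interior point seen from the vertex. Acuteness makes \<open>a\<close> finite, and the exclusion of
  angle 0 makes it positive. The cone for given \<delta> lies in a triangle spanned by the vertex, a
  nearby point of the first arc and that interior point.\<close>

lemma corner_coordinates:
  assumes \<Omega>: "open \<Omega>" "convex \<Omega>" "\<Omega> \<noteq> {}"
    and corner: "boundary_corner s \<Omega> \<gamma> \<gamma>' \<theta>" "\<theta> < pi / 2"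
  obtains V e n a b where "e \<bullet> e = 1" "n \<bullet> n = 1" "e \<bullet> n = 0" "0 < a" "0 < b"
    "\<And>w. w \<in> \<Omega> \<Longrightarrow> 0 < (w - V) \<bullet> n"
    "\<And>w. w \<in> \<Omega> \<Longrightarrow> (w - V) \<bullet> n < a * ((w - V) \<bullet> e)"
    "\<And>\<delta>. 0 < \<delta> \<Longrightarrow> \<exists>\<eta>>0. \<forall>x y. 0 < x \<and> x < \<eta> \<and> \<delta> * x < y \<and> y < b * x \<longrightarrow> V + x *\<^sub>R e + y *\<^sub>R n \<in> \<Omega>"
proof -
  define V where "V = \<gamma> 0"
  have \<gamma>: "C1_holder_arc s \<gamma>" "path_image \<gamma> \<subseteq> frontier \<Omega>" "path_image \<gamma> \<subseteq> closure \<Omega>" "\<gamma> 0 = V"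
    and \<gamma>': "C1_holder_arc s \<gamma>'" "path_image \<gamma>' \<subseteq> frontier \<Omega>" "path_image \<gamma>' \<subseteq> closure \<Omega>" "\<gamma>' 0 = V"
    and int: "path_image \<gamma> \<inter> path_image \<gamma>' = {V}" and \<theta>: "\<theta> = vec_angle (velocity \<gamma> 0) (velocity \<gamma>' 0)"
    using corner(1) by (auto simp: boundary_corner_def V_def pathstart_def frontier_def)
  define v v' where "v = velocity \<gamma> 0" and "v' = velocity \<gamma>' 0"
  have nz: "v \<noteq> 0" "v' \<noteq> 0" using \<gamma>(1) \<gamma>'(1) by (auto simp: C1_holder_arc_def v_def v'_def)
  have acute: "0 < v \<bullet> v'"
  proof (rule ccontr)
    assume "\<not> 0 < v \<bullet> v'"
    then have "(v \<bullet> v') / (norm v * norm v') \<le> 0" using nz by (simp add: divide_nonpos_pos)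
    moreover have "- 1 \<le> (v \<bullet> v') / (norm v * norm v')"
      using Cauchy_Schwarz_ineq2[of v v'] nz by (simp add: field_simps abs_le_iff)
    ultimately have "arccos 0 \<le> arccos ((v \<bullet> v') / (norm v * norm v'))" by (intro arccos_le_arccos) auto
    then show False using corner(2) \<theta> by (simp add: vec_angle_def v_def v'_def)
  qed
  define e where "e = (1 / norm v) *\<^sub>R v"
  have e: "e \<bullet> e = 1" "v = norm v *\<^sub>R e"
    using nz by (simp_all add: e_def power2_norm_eq_inner[symmetric] power2_eq_square)
  have off: "V + x *\<^sub>R v \<notin> \<Omega>" "V + x *\<^sub>R v' \<notin> \<Omega>" for x
    using tangent_line_avoids[OF \<Omega>(1,2) \<gamma>(1,2), of x] tangent_line_avoids[OF \<Omega>(1,2) \<gamma>'(1,2), of x] \<gamma>(4) \<gamma>'(4)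
    by (simp_all add: v_def v'_def)
  have "(w - V) \<bullet> rot90 e \<noteq> 0" if "w \<in> \<Omega>" for w
  proof
    assume "(w - V) \<bullet> rot90 e = 0"
    then have "w - V = ((w - V) \<bullet> e) *\<^sub>R e" using rot90_expand[OF e(1), of "w - V"] by simp
    also have "\<dots> = ((w - V) \<bullet> e / norm v) *\<^sub>R v" by (simp add: e_def)
    finally have "V + ((w - V) \<bullet> e / norm v) *\<^sub>R v = w" by (metis add.commute diff_add_cancel)
    then show False using off(1) that by metis
  qed
  from convex_inner_sign[OF \<Omega>(2) this]
  obtain n where n: "n = rot90 e \<or> n = - rot90 e" and npos: "\<And>w. w \<in> \<Omega> \<Longrightarrow> 0 < (w - V) \<bullet> n"
  proof
    assume "\<forall>w\<in>\<Omega>. 0 < (w - V) \<bullet> rot90 e"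
    then show ?thesis using that[of "rot90 e"] by blast
  next
    assume "\<forall>w\<in>\<Omega>. (w - V) \<bullet> rot90 e < 0"
    then show ?thesis using that[of "- rot90 e"] by simp
  qed
  have nn: "n \<bullet> n = 1" "e \<bullet> n = 0" using n e(1) by auto
  have frame: "z = (z \<bullet> e) *\<^sub>R e + (z \<bullet> n) *\<^sub>R n" for z using rot90_expand[OF e(1), of z] n by auto
  have ve: "v \<bullet> e = norm v" "v \<bullet> n = 0" using e nn by (metis inner_scaleR_left mult.right_neutral, metis inner_scaleR_left mult_zero_right)
  have v'e: "0 < v' \<bullet> e" using acute nz by (simp add: e_def inner_commute)
  have "v' \<bullet> n \<noteq> 0"
    using tangent_arcs_meet[OF \<Omega>(1,2) frame npos \<gamma>(1,2,4) _ _ \<gamma>'(1,2,4)] int ve v'e nz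
    by (auto simp: v_def v'_def)
  moreover have "0 \<le> v' \<bullet> n"
    unfolding v'_def by (rule velocity_inner_nonneg[OF \<gamma>'(1,3)]) (use npos \<gamma>'(4) in \<open>auto intro: less_imp_le\<close>)
  ultimately have v'n: "0 < v' \<bullet> n" by simp
  define m where "m = (v' \<bullet> n) *\<^sub>R e - (v' \<bullet> e) *\<^sub>R n"
  have "(w - V) \<bullet> m \<noteq> 0" if "w \<in> \<Omega>" for w
  proof
    assume 0: "(w - V) \<bullet> m = 0"
    define x where "x = ((w - V) \<bullet> n) / (v' \<bullet> n)"
    have "(v' \<bullet> n) * ((w - V) \<bullet> e) = (v' \<bullet> e) * ((w - V) \<bullet> n)"
      using 0 by (simp add: m_def inner_diff_right)
    then have "(w - V) \<bullet> e = x * (v' \<bullet> e)" "(w - V) \<bullet> n = x * (v' \<bullet> n)"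
      using v'n by (simp_all add: x_def field_simps)
    then have "w - V = x *\<^sub>R v'" using frame[of "w - V"] frame[of v']
      by (metis scaleR_add_right scaleR_scaleR)
    then have "V + x *\<^sub>R v' = w" by (metis add.commute diff_add_cancel)
    then show False using off(2) that by metis
  qed
  note sign = convex_inner_sign[OF \<Omega>(2) this]
  \<comment> \<open>The first arc decides on which side of the second tangent line the domain lies:
    its velocity has positive inner product with \<open>m\<close>.\<close>
  have "\<not> (\<forall>w\<in>\<Omega>. (w - V) \<bullet> m < 0)"
  proof
    assume neg: "\<forall>w\<in>\<Omega>. (w - V) \<bullet> m < 0"
    have "0 \<le> velocity \<gamma> 0 \<bullet> (- m)"
      by (rule velocity_inner_nonneg[OF \<gamma>(1,3)]) (use neg \<gamma>(4) in \<open>auto intro: less_imp_le\<close>)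
    then have "norm v * (v' \<bullet> n) \<le> 0" using ve by (simp add: m_def inner_diff_right v_def mult.commute)
    then show False using nz v'n by (simp add: mult_le_0_iff)
  qed
  with sign have mpos: "0 < (w - V) \<bullet> m" if "w \<in> \<Omega>" for w using that by blast
  define a where "a = (v' \<bullet> n) / (v' \<bullet> e)"
  have a: "0 < a" using v'n v'e by (simp add: a_def)
  have wedge: "(w - V) \<bullet> n < a * ((w - V) \<bullet> e)" if "w \<in> \<Omega>" for w
    using mpos[OF that] v'e by (simp add: m_def a_def inner_diff_right field_simps)
  obtain w where w: "w \<in> \<Omega>" using \<Omega>(3) by blast
  define X Y where "X = (w - V) \<bullet> e" and "Y = (w - V) \<bullet> n"
  have Y: "0 < Y" using npos[OF w] by (simp add: Y_def)
  have "0 < a * X" using wedge[OF w] Y by (simp add: X_def Y_def)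
  then have X: "0 < X" using a by (simp add: zero_less_mult_iff)
  define b where "b = Y / X"
  have b: "0 < b" "Y = b * X" using X Y by (auto simp: b_def)
  have cone: "\<exists>\<eta>>0. \<forall>x y. 0 < x \<and> x < \<eta> \<and> \<delta> * x < y \<and> y < b * x \<longrightarrow> V + x *\<^sub>R e + y *\<^sub>R n \<in> \<Omega>"
    if \<delta>: "0 < \<delta>" for \<delta>
  proof -
    have mb: "0 < min \<delta> b" using \<delta> b by simp
    obtain d where d: "0 < d" "d \<le> 1" "\<And>t. 0 < t \<Longrightarrow> t \<le> d \<Longrightarrow> 0 < (\<gamma> t - \<gamma> 0) \<bullet> e \<and> \<bar>(\<gamma> t - \<gamma> 0) \<bullet> n\<bar> < min \<delta> b * ((\<gamma> t - \<gamma> 0) \<bullet> e)"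
      by (rule eventually_at_right_unit[OF arc_slope[OF \<gamma>(1) _ _ mb, of e n]]) (use ve nz v_def in auto)
    define P Q where "P = (\<gamma> d - V) \<bullet> e" and "Q = (\<gamma> d - V) \<bullet> n"
    have P: "0 < P" and Q: "\<bar>Q\<bar> < min \<delta> b * P" using d(3)[of d] d(1) \<gamma>(4) by (auto simp: P_def Q_def)
    have Q': "Q < \<delta> * P" "Q < b * P" "- (b * P) < Q"
    proof -
      define k where "k = min \<delta> b"
      have "k \<le> \<delta>" "k \<le> b" by (simp_all add: k_def)
      then have "k * P \<le> \<delta> * P" "k * P \<le> b * P" using P by (simp_all add: mult_right_mono)
      then show "Q < \<delta> * P" "Q < b * P" "- (b * P) < Q" using Q unfolding k_def[symmetric] by linarith+
    qed
    define D where "D = P * Y - Q * X"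
    have "D = (b * P - Q) * X" by (simp add: D_def b(2) left_diff_distrib)
    then have D: "0 < D" using Q'(2) X by simp
    have gc: "\<gamma> d \<in> closure \<Omega>" using \<gamma>(3) d by (auto simp: path_image_def)
    have Vc: "V \<in> closure \<Omega>" using \<gamma>(3) \<gamma>(4) by (auto simp: path_image_def)
    \<comment> \<open>This bound on \<open>x\<close> is what forces \<alpha> + \<beta> < 1
      below.\<close>
    define \<eta> where "\<eta> = D / (Y + 2 * b * P)"
    have den: "0 < Y + 2 * b * P" using Y b P by (simp add: add_pos_pos)
    show ?thesis
    proof (intro exI[of _ \<eta>] conjI allI impI)
      show "0 < \<eta>" using D den by (simp add: \<eta>_def)
      fix x y assume xy: "0 < x \<and> x < \<eta> \<and> \<delta> * x < y \<and> y < b * x"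
      \<comment> \<open>Cramer's rule: these are the coordinates of the point in the basis
        \<open>\<gamma> d - V\<close>, \<open>w - V\<close>, whose determinant in the frame is
        \<open>D\<close>.\<close>
      define \<alpha> \<beta> where "\<alpha> = (x * Y - y * X) / D" and "\<beta> = (P * y - Q * x) / D"
      have "x * Y - y * X = (b * x - y) * X" by (simp add: b(2) left_diff_distrib)
      then have \<alpha>: "0 < \<alpha>" using xy X D by (simp add: \<alpha>_def)
      have "Q * x < \<delta> * P * x" using Q'(1) xy by simp
      also have "\<dots> < P * y" using xy P by (simp add: mult.commute mult.left_commute)
      finally have \<beta>: "0 < \<beta>" using D by (simp add: \<beta>_def)
      have "x * Y - y * X + (P * y - Q * x) < x * (Y + 2 * b * P)"
      proof -
        have "0 < y" using xy \<delta> by (meson less_trans mult_pos_pos)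
        then have "0 < y * X" using X by simp
        moreover have "P * y < P * (b * x)" using xy P by simp
        moreover have "- (b * P) * x < Q * x" using Q'(3) xy by (intro mult_strict_right_mono) auto
        ultimately show ?thesis by (simp add: algebra_simps)
      qed
      also have "\<dots> < D" using xy den by (simp add: \<eta>_def field_simps)
      finally have "\<alpha> + \<beta> < 1" using D by (simp add: \<alpha>_def \<beta>_def flip: add_divide_distrib)
      then have \<beta>1: "\<beta> < 1" and ab: "\<alpha> / (1 - \<beta>) \<le> 1" using \<alpha> \<beta> by auto
      \<comment> \<open>The point of the open triangle is reached from the interior point
        \<open>w\<close> through \<open>q\<close> on the side from \<open>V\<close> to
        \<open>\<gamma> d\<close>, so only one shrinking step towards the interior is used.\<close>
      define q where "q = (1 - \<alpha> / (1 - \<beta>)) *\<^sub>R V + (\<alpha> / (1 - \<beta>)) *\<^sub>R \<gamma> d"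
      have "q \<in> closure \<Omega>" unfolding q_def
        by (rule convexD[OF convex_closure[OF \<Omega>(2)] Vc gc]) (use ab \<alpha> \<beta>1 in auto)
      then have "q + \<beta> *\<^sub>R (w - q) \<in> \<Omega>"
        by (rule open_convex_segment[OF \<Omega>(1,2) _ w \<beta>]) (use \<beta>1 in simp)
      also have "q + \<beta> *\<^sub>R (w - q) = V + \<alpha> *\<^sub>R (\<gamma> d - V) + \<beta> *\<^sub>R (w - V)"
      proof -
        have "q = V + (\<alpha> / (1 - \<beta>)) *\<^sub>R (\<gamma> d - V)" by (simp add: q_def algebra_simps)
        moreover have "q + \<beta> *\<^sub>R (w - q) = V + (1 - \<beta>) *\<^sub>R (q - V) + \<beta> *\<^sub>R (w - V)" by (simp add: algebra_simps)
        ultimately show ?thesis using \<beta>1 by simp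
      qed
      also have "\<alpha> *\<^sub>R (\<gamma> d - V) = \<alpha> *\<^sub>R (P *\<^sub>R e + Q *\<^sub>R n)"
        using frame[of "\<gamma> d - V"] by (simp only: P_def Q_def)
      also have "\<beta> *\<^sub>R (w - V) = \<beta> *\<^sub>R (X *\<^sub>R e + Y *\<^sub>R n)"
        using frame[of "w - V"] by (simp only: X_def Y_def)
      also have "V + \<alpha> *\<^sub>R (P *\<^sub>R e + Q *\<^sub>R n) + \<beta> *\<^sub>R (X *\<^sub>R e + Y *\<^sub>R n)
          = V + (\<alpha> * P + \<beta> * X) *\<^sub>R e + (\<alpha> * Q + \<beta> * Y) *\<^sub>R n" by (simp add: algebra_simps)
      also have "\<alpha> * P + \<beta> * X = x"
      proof -
        have "\<alpha> * P + \<beta> * X = x * D / D" by (simp add: \<alpha>_def \<beta>_def D_def algebra_simps flip: add_divide_distrib diff_divide_distrib)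
        then show ?thesis using D by simp
      qed
      also have "\<alpha> * Q + \<beta> * Y = y"
      proof -
        have "\<alpha> * Q + \<beta> * Y = y * D / D" by (simp add: \<alpha>_def \<beta>_def D_def algebra_simps flip: add_divide_distrib diff_divide_distrib)
        then show ?thesis using D by simp
      qed
      finally show "V + x *\<^sub>R e + y *\<^sub>R n \<in> \<Omega>" .
    qed
  qed
  show ?thesis by (rule that[OF e(1) nn a b(1) npos wedge cone])
qed

text \<open>The quadratic y (a x - y) is nonnegative on the closed wedge and has Laplacian -2;
  against -1 for \<open>u\<close> this leaves the strict gap that the minimum principle asks for.
  Discarding -y^2 at the end leaves a bound with hyperbolic level lines.\<close>

lemma wedge_barrier:
  fixes \<Omega> :: "(real^2) set"
  assumes "convex_torsion \<Omega> u G H" and en: "e \<bullet> n = 0" "n \<bullet> n = 1"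
    and side: "\<And>w. w \<in> \<Omega> \<Longrightarrow> 0 < (w - V) \<bullet> n"
    and wedge: "\<And>w. w \<in> \<Omega> \<Longrightarrow> (w - V) \<bullet> n < a * ((w - V) \<bullet> e)"
    and w: "w \<in> \<Omega>"
  shows "u w \<le> ((w - V) \<bullet> n) * (a * ((w - V) \<bullet> e))"
proof -
  interpret convex_torsion \<Omega> u G H by fact
  let ?y = "\<lambda>z. (z - V) \<bullet> n" and ?x = "\<lambda>z. (z - V) \<bullet> e"
  define q where "q z = ?y z * (a * ?x z - ?y z)" for z
  define Gq where "Gq z = (a * ?x z - 2 * ?y z) *\<^sub>R n + (a * ?y z) *\<^sub>R e" for z
  define Hq where "Hq z h = (a * (h \<bullet> e) - 2 * (h \<bullet> n)) *\<^sub>R n + (a * (h \<bullet> n)) *\<^sub>R e" for z h :: "real^2"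
  have so: "second_order \<Omega> q Gq Hq"
    unfolding second_order_def
  proof (intro ballI conjI)
    fix x assume "x \<in> \<Omega>"
    show "(q has_derivative (\<lambda>h. Gq x \<bullet> h)) (at x)"
      unfolding q_def Gq_def
      by (auto intro!: derivative_eq_intros simp: algebra_simps inner_commute)
    show "(Gq has_derivative Hq x) (at x)"
      unfolding Gq_def[abs_def] Hq_def[abs_def] by (auto intro!: derivative_eq_intros)
  qed
  have tr: "(\<Sum>b\<in>Basis. Hq z b \<bullet> b) = - 2" for z
  proof -
    have "(\<Sum>b\<in>Basis. Hq z b \<bullet> b) = (\<Sum>b\<in>Basis. 2 * a * ((e \<bullet> b) * (n \<bullet> b)) - 2 * ((n \<bullet> b) * (n \<bullet> b)))"
      by (rule sum.cong) (auto simp: Hq_def algebra_simps inner_commute)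
    also have "\<dots> = 2 * a * (e \<bullet> n) - 2 * (n \<bullet> n)"
      unfolding sum_subtractf by (simp flip: sum_distrib_left euclidean_inner)
    finally show ?thesis using en by simp
  qed
  have "0 < q w - u w"
  proof (rule strict_minimum_principle[OF open_S bounded_S second_order_diff[OF so second_order] _ _ _ w])
    show "continuous_on (closure \<Omega>) (\<lambda>x. q x - u x)"
      unfolding q_def by (intro continuous_intros continuous)
    show "(\<Sum>b\<in>Basis. (Hq x b - H x b) \<bullet> b) < 0" if "x \<in> \<Omega>" for x
      using tr[of x] trace[OF that] by (simp add: inner_diff_left sum_subtractf)
    show "0 \<le> q x - u x" if "x \<in> frontier \<Omega>" for x
    proof -
      have x: "x \<in> closure \<Omega>" using that by (simp add: frontier_def)
      have "0 \<le> ?y x" 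
        by (rule closure_inner_nonneg[OF _ x]) (use side in \<open>auto intro: less_imp_le\<close>)
      moreover have "0 \<le> (x - V) \<bullet> (a *\<^sub>R e - n)"
        by (rule closure_inner_nonneg[OF _ x]) (use wedge in \<open>auto simp: inner_diff_right intro: less_imp_le\<close>)
      ultimately show ?thesis using boundary[OF that] by (simp add: q_def inner_diff_right)
    qed
  qed
  then have "u w \<le> ?y w * (a * ?x w) - ?y w * ?y w" by (simp add: q_def right_diff_distrib)
  then show ?thesis by (smt (verit) zero_le_square)
qed

section \<open>Area of the sublevel set and the essential supremum\<close>

lemma frame_rectangle:
  fixes e n V :: "real^2"
  assumes en: "e \<bullet> e = 1" "n \<bullet> n = 1" "e \<bullet> n = 0" and le: "x1 \<le> x2" "y1 \<le> y2"
  defines "R \<equiv> (\<lambda>z::real^2. V + (z $ 1) *\<^sub>R e + (z $ 2) *\<^sub>R n) ` {z. x1 < z $ 1 \<and> z $ 1 < x2 \<and> y1 < z $ 2 \<and> z $ 2 < y2}"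
  shows "R \<in> lmeasurable" "measure lebesgue R = (x2 - x1) * (y2 - y1)"
proof -
  define T where "T z = (z $ 1) *\<^sub>R e + (z $ 2) *\<^sub>R n" for z :: "real^2"
  have T: "orthogonal_transformation T"
    unfolding orthogonal_transformation_def
  proof
    show "linear T" unfolding T_def by (rule linearI) (simp_all add: algebra_simps)
    show "\<forall>v w. T v \<bullet> T w = v \<bullet> w"
      using en by (simp add: T_def inner_add_left inner_add_right inner_commute[of n e])
        (simp add: inner_real2)
  qed
  define B where "B = box (vector [x1, y1] :: real^2) (vector [x2, y2])"
  have B: "B = {z. x1 < z $ 1 \<and> z $ 1 < x2 \<and> y1 < z $ 2 \<and> z $ 2 < y2}"
    by (auto simp: B_def mem_box_cart forall_2)
  have Bm: "B \<in> lmeasurable" by (simp add: B_def)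
  have mB: "measure lebesgue B = (x2 - x1) * (y2 - y1)"
  proof -
    have "measure lebesgue B = measure lborel B" by (simp add: B_def)
    also have "\<dots> = (\<Prod>b\<in>Basis. (vector [x2, y2] - vector [x1, y1] :: real^2) \<bullet> b)"
    proof -
      have "\<forall>b\<in>Basis. (vector [x1, y1] :: real^2) \<bullet> b \<le> vector [x2, y2] \<bullet> b"
        using le by (simp add: Basis_real2 inner_axis)
      then show ?thesis unfolding B_def by (subst measure_lborel_box_eq) auto
    qed
    also have "\<dots> = (x2 - x1) * (y2 - y1)"
      by (simp add: Basis_real2 inner_axis axis_eq_axis)
    finally show ?thesis .
  qed
  have R: "R = (+) V ` (T ` B)" unfolding R_def B T_def by (auto simp: image_image add.assoc)
  show "R \<in> lmeasurable" unfolding R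
    by (intro measurable_translation measurable_orthogonal_image T Bm)
  show "measure lebesgue R = (x2 - x1) * (y2 - y1)"
    unfolding R measure_translation measure_orthogonal_image[OF T Bm] mB ..
qed

text \<open>Each of the \<^term>\<open>N\<close> dyadic rectangles has area \<^term>\<open>c / (4 * a)\<close>. This is the
  logarithmic divergence of the integral of \<open>1 / \<bar>\<nabla>u\<bar>\<close> along the side of the corner.\<close>

lemma corner_sublevel_area:
  fixes \<Omega> :: "(real^2) set" and N :: nat
  assumes \<Omega>: "open \<Omega>" "bounded \<Omega>" and en: "e \<bullet> e = 1" "n \<bullet> n = 1" "e \<bullet> n = 0" and ab: "0 < a" "0 < b"
    and u: "\<And>w. w \<in> \<Omega> \<Longrightarrow> u w \<le> ((w - V) \<bullet> n) * (a * ((w - V) \<bullet> e))"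
    and cone: "\<And>\<delta>. 0 < \<delta> \<Longrightarrow> \<exists>\<eta>>0. \<forall>x y. 0 < x \<and> x < \<eta> \<and> \<delta> * x < y \<and> y < b * x \<longrightarrow> V + x *\<^sub>R e + y *\<^sub>R n \<in> \<Omega>"
    and op: "\<And>c. open {w \<in> \<Omega>. c < u w}" and \<epsilon>: "0 < \<epsilon>"
  shows "\<exists>c>0. c < \<epsilon> \<and> measure lebesgue {w \<in> \<Omega>. c < u w} \<le> measure lebesgue \<Omega> - N * (c / (4 * a))"
proof -
  \<comment> \<open>The lowest slope in rectangle \<open>k\<close> is that of its lower right
    corner, (Y k / 2) / (2 X k) = b / 4^(k+1). For all k < N this exceeds \<delta>, so one cone
    contains every rectangle.\<close>
  define \<delta> where "\<delta> = b / 4 ^ Suc N"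
  have \<delta>: "0 < \<delta>" using ab by (simp add: \<delta>_def)
  obtain \<eta> where \<eta>: "0 < \<eta>" "\<And>x y. 0 < x \<Longrightarrow> x < \<eta> \<Longrightarrow> \<delta> * x < y \<Longrightarrow> y < b * x \<Longrightarrow> V + x *\<^sub>R e + y *\<^sub>R n \<in> \<Omega>"
    using cone[OF \<delta>] by blast
  \<comment> \<open>The first bound keeps all \<open>N\<close> rectangles at abscissae below \<eta>;
    the other two give c < \<epsilon>.\<close>
  have "0 < min (\<eta> / 2 ^ Suc N) (min 1 (\<epsilon> / (4 * a * b)))" using \<eta> ab \<epsilon> by simp
  then obtain \<sigma> where "0 < \<sigma>" "\<sigma> \<le> min (\<eta> / 2 ^ Suc N) (min 1 (\<epsilon> / (4 * a * b)))" by blast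
  then have \<sigma>: "0 < \<sigma>" "\<sigma> \<le> \<eta> / 2 ^ Suc N" "\<sigma> \<le> 1" "\<sigma> \<le> \<epsilon> / (4 * a * b)" by (simp_all only: min.bounded_iff)
  define c where "c = 2 * a * b * \<sigma>\<^sup>2"
  have c: "0 < c" using ab \<sigma> by (simp add: c_def)
  have "\<sigma>\<^sup>2 \<le> \<sigma>" using \<sigma> by (simp add: power2_eq_square mult_left_le)
  then have "c \<le> 2 * a * b * \<sigma>" unfolding c_def using ab by (intro mult_left_mono) auto
  also have "\<dots> \<le> \<epsilon> / 2" using \<sigma>(4) ab by (simp add: field_simps)
  also have "\<dots> < \<epsilon>" using \<epsilon> by simp
  finally have c\<epsilon>: "c < \<epsilon>" .
  \<comment> \<open>The abscissa doubles while the ordinate halves, so the upper right corners (2 X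
    k, Y k) all lie on the single hyperbola a x y = c, and all rectangles have the same
    area.\<close>
  define X where "X k = 2 ^ k * \<sigma>" for k
  define Y where "Y k = b * \<sigma> / 2 ^ k" for k
  have X: "0 < X k" "X (Suc k) = 2 * X k" for k using \<sigma> by (auto simp: X_def)
  have Y: "0 < Y k" for k using \<sigma> ab by (auto simp: Y_def)
  have XY: "X k * Y k = b * \<sigma>\<^sup>2" for k by (simp add: X_def Y_def power2_eq_square)
  define R where "R k = (\<lambda>z::real^2. V + (z $ 1) *\<^sub>R e + (z $ 2) *\<^sub>R n) `
      {z. X k < z $ 1 \<and> z $ 1 < 2 * X k \<and> Y k / 2 < z $ 2 \<and> z $ 2 < Y k}" for k
  have Rm: "R k \<in> lmeasurable" and mR: "measure lebesgue (R k) = c / (4 * a)" for k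
  proof -
    have *: "X k \<le> 2 * X k" "Y k / 2 \<le> Y k" using X(1)[of k] Y[of k] by auto
    show "R k \<in> lmeasurable" unfolding R_def by (rule frame_rectangle(1)[OF en *])
    have "measure lebesgue (R k) = (2 * X k - X k) * (Y k - Y k / 2)"
      unfolding R_def by (rule frame_rectangle(2)[OF en *])
    also have "\<dots> = X k * Y k / 2" by simp
    finally show "measure lebesgue (R k) = c / (4 * a)" using ab by (simp add: XY c_def)
  qed
  have coord: "(V + x *\<^sub>R e + y *\<^sub>R n - V) \<bullet> e = x" "(V + x *\<^sub>R e + y *\<^sub>R n - V) \<bullet> n = y" for x y
    using en by (simp_all add: inner_add_left inner_commute[of n e])
  have R\<Omega>: "w \<in> \<Omega> \<and> u w \<le> c" if wR: "w \<in> R k" and k: "k < N" for w k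
  proof -
    obtain z :: "real^2" where z: "w = V + (z $ 1) *\<^sub>R e + (z $ 2) *\<^sub>R n"
        "X k < z $ 1" "z $ 1 < 2 * X k" "Y k / 2 < z $ 2" "z $ 2 < Y k"
      using wR unfolding R_def by blast
    define x y where "x = z $ 1" and "y = z $ 2"
    have w: "w = V + x *\<^sub>R e + y *\<^sub>R n" and xy: "X k < x" "x < 2 * X k" "Y k / 2 < y" "y < Y k"
      using z by (simp_all add: x_def y_def)
    have x0: "0 < x" using X(1)[of k] xy by linarith
    have "x < \<eta>"
    proof -
      have "2 * X k = 2 ^ Suc k * \<sigma>" by (simp add: X_def)
      also have "\<dots> \<le> 2 ^ N * \<sigma>" using k \<sigma>(1) by (intro mult_right_mono power_increasing) auto
      also have "\<dots> < \<eta>" using \<sigma> \<eta>(1) by (simp add: field_simps)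
      finally show ?thesis using xy by simp
    qed
    moreover have "\<delta> * x < y"
    proof -
      have "\<delta> * x \<le> \<delta> * (2 * X k)" using xy \<delta> by simp
      also have "\<dots> \<le> Y k / 2"
      proof -
        have "(4::real) ^ Suc k \<le> 4 ^ Suc N" using k by (intro power_increasing) auto
        then have "b / 4 ^ Suc N \<le> b / 4 ^ Suc k" using ab by (intro divide_left_mono) auto
        then have "\<delta> * (2 * X k) \<le> b / 4 ^ Suc k * (2 * X k)"
          unfolding \<delta>_def using X(1)[of k] by (intro mult_right_mono) auto
        also have "\<dots> = Y k / 2"
          by (simp add: X_def Y_def field_simps flip: power_mult_distrib)
        finally show ?thesis .
      qed
      finally show ?thesis using xy by simp
    qed
    moreover have "y < b * x"
    proof -
      have "b * \<sigma> / 2 ^ k \<le> b * \<sigma> / 1" using ab \<sigma> by (intro divide_left_mono) auto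
      then have "Y k \<le> b * \<sigma>" by (simp add: Y_def)
      also have "\<dots> \<le> b * X k"
        using ab mult_right_mono[of 1 "2 ^ k" \<sigma>] \<sigma> by (intro mult_left_mono) (auto simp: X_def)
      also have "\<dots> < b * x" using ab xy by simp
      finally show ?thesis using xy by simp
    qed
    ultimately have w\<Omega>: "w \<in> \<Omega>" unfolding w using \<eta>(2) x0 by blast
    have "u w \<le> y * (a * x)" using u[OF w\<Omega>] unfolding w coord .
    also have "\<dots> \<le> Y k * (a * (2 * X k))"
      using xy ab x0 Y[of k] by (intro mult_mono) auto
    also have "\<dots> = c" using XY[of k] by (simp add: c_def mult_ac)
    finally show ?thesis using w\<Omega> by blast
  qed
  have strip: "X k < (w - V) \<bullet> e \<and> (w - V) \<bullet> e < 2 * X k" if "w \<in> R k" for w k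
    using that unfolding R_def by (auto simp only: coord mem_Collect_eq)
  have disj: "disjoint_family_on R {..<N}"
  proof -
    have "R i \<inter> R j = {}" if "i < j" for i j
    proof (rule ccontr)
      assume "R i \<inter> R j \<noteq> {}"
      then obtain w where "w \<in> R i" "w \<in> R j" by blast
      then have w: "(w - V) \<bullet> e < 2 * X i" "X j < (w - V) \<bullet> e" using strip by blast+
      have "X (Suc i) \<le> X j" unfolding X_def using that \<sigma> by (intro mult_right_mono power_increasing) auto
      then show False using w X(2)[of i] by simp
    qed
    then show ?thesis unfolding disjoint_family_on_def by (metis inf_commute nat_neq_iff)
  qed
  define U where "U = (\<Union>k<N. R k)"
  have Um: "U \<in> lmeasurable" unfolding U_def by (intro fmeasurable.finite_UN) (use Rm in auto)
  have mU: "measure lebesgue U = N * (c / (4 * a))"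
  proof -
    have "measure lebesgue U = (\<Sum>k<N. measure lebesgue (R k))"
      unfolding U_def
    proof (rule measure_finite_Union[OF finite_lessThan _ disj])
      show "R ` {..<N} \<subseteq> sets lebesgue" using fmeasurableD[OF Rm] by blast
      show "emeasure lebesgue (R k) \<noteq> \<infinity>" for k
        using fmeasurableD2[OF Rm] by (simp only: infinity_ennreal_def not_False_eq_True)
    qed
    then show ?thesis using mR by simp
  qed
  have U\<Omega>: "U \<subseteq> \<Omega>" using R\<Omega> by (auto simp: U_def)
  have \<Omega>m: "\<Omega> \<in> lmeasurable" using \<Omega> by (rule lmeasurable_open[rotated])
  have "measure lebesgue {w \<in> \<Omega>. c < u w} \<le> measure lebesgue (\<Omega> - U)"
  proof (rule measure_mono_fmeasurable)
    show "{w \<in> \<Omega>. c < u w} \<subseteq> \<Omega> - U" using R\<Omega> by (force simp: U_def)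
    show "{w \<in> \<Omega>. c < u w} \<in> sets lebesgue" using op by (simp add: borel_open sets_completionI_sets)
    show "\<Omega> - U \<in> lmeasurable" using \<Omega>m Um by (intro fmeasurable.Diff) auto
  qed
  also have "\<dots> = measure lebesgue \<Omega> - N * (c / (4 * a))"
    using measurable_measure_Diff[OF \<Omega>m _ U\<Omega>] Um mU by (simp add: fmeasurableD)
  finally show ?thesis using c c\<epsilon> by blast
qed

text \<open>By continuity the set where the norm exceeds the essential supremum is open, and it is
  null; a nonempty open set has positive measure. Hence the essential supremum bounds the gradient
  at every point.\<close>

lemma Linf_norm_upper:
  assumes "open \<Omega>" "continuous_on \<Omega> f" "x \<in> \<Omega>"
  shows "ereal (norm (f x)) \<le> Linf_norm \<Omega> f"
proof (rule ccontr)
  assume neg: "\<not> ?thesis"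
  define L where "L = Linf_norm \<Omega> f"
  define W where "W = \<Omega> \<inter> (\<lambda>y. norm (f y)) -` (ereal -` {L<..})"
  have "open (ereal -` {L<..})" by (intro open_ereal_vimage open_greaterThan)
  moreover have "continuous_on \<Omega> (\<lambda>y. norm (f y))" by (intro continuous_intros assms)
  ultimately have W: "open W" unfolding W_def
    using assms(1) by (intro continuous_open_preimage)
  have "x \<in> W" using neg assms(3) by (simp add: L_def W_def)
  with W have "\<not> negligible W" using open_not_negligible by blast
  moreover have "W \<in> null_sets lebesgue"
  proof -
    have "AE y in lebesgue. y \<in> \<Omega> \<longrightarrow> ereal (norm (f y)) \<le> L"
      using esssup_AE[where M = "lebesgue_on \<Omega>" and f = "\<lambda>y. ereal (norm (f y))"] assms(1)
      by (simp add: L_def Linf_norm_def AE_restrict_space_iff borel_open sets_completionI_sets)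
    then have "AE y in lebesgue. y \<notin> W" by (rule eventually_mono) (auto simp: W_def)
    moreover have "W \<in> sets lebesgue" using W by (simp add: borel_open sets_completionI_sets)
    ultimately show ?thesis by (simp only: AE_iff_null_sets)
  qed
  ultimately show False by (simp add: negligible_iff_null_sets)
qed

lemma Linf_norm_least:
  assumes "open \<Omega>" "continuous_on \<Omega> f" "\<And>x. x \<in> \<Omega> \<Longrightarrow> norm (f x) \<le> B"
  shows "Linf_norm \<Omega> f \<le> ereal B"
  unfolding Linf_norm_def
proof (rule esssup_I)
  have "(\<lambda>x. norm (f x)) \<in> borel_measurable (lebesgue_on \<Omega>)"
    using assms by (intro continuous_imp_measurable_on_sets_lebesgue continuous_intros)
      (simp_all add: borel_open sets_completionI_sets)
  then show "(\<lambda>x. ereal (norm (f x))) \<in> borel_measurable (lebesgue_on \<Omega>)" by simp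
  show "AE x in lebesgue_on \<Omega>. ereal (norm (f x)) \<le> ereal B"
    by (rule AE_I2) (use assms(3) in simp)
qed

text \<open>A vanishing gradient on an open set would have zero derivative, against trace -1. This
  gives a positive supremum of the gradient in the final division.\<close>

lemma gradient_not_identically_zero:
  assumes "convex_torsion S u G H" "S \<noteq> {}"
  shows "\<exists>x\<in>S. G x \<noteq> 0"
proof (rule ccontr)
  interpret convex_torsion S u G H by fact
  assume "\<not> ?thesis"
  then have 0: "G y = 0" if "y \<in> S" for y using that by blast
  obtain x where x: "x \<in> S" using assms(2) by blast
  have "((\<lambda>_. 0) has_derivative H x) (at x)"
    by (rule has_derivative_transform_within_open[OF _ open_S x 0])
      (use second_order x in \<open>auto simp: second_order_def\<close>)
  then have "H x = (\<lambda>_. 0)" by (rule has_derivative_unique) (rule has_derivative_const)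
  then show False using trace[OF x] by simp
qed

section \<open>The balance of gradient loss against area loss\<close>

theorem theorem1p1:
  fixes \<Omega> :: "(real^2) set" and u :: "real^2 \<Rightarrow> real" and p :: "real^2" and \<alpha> \<beta> :: real
  assumes "bounded_convex_domain \<Omega>" and "torsion_function \<Omega> u"
    and maximizer: "\<And>\<Omega>' u'. bounded_convex_domain \<Omega>' \<Longrightarrow> torsion_function \<Omega>' u' \<Longrightarrow>
                      gradient_ratio \<Omega>' u' \<le> gradient_ratio \<Omega> u"
    and "extremal_point \<Omega> u p"
    and "0 < \<alpha>" and "\<alpha> \<le> 1" and "C1_holder_boundary_near \<alpha> \<Omega> p"
    and "0 < \<beta>" and "\<beta> < 1"
  shows "\<not> (\<exists>\<gamma>\<^sub>1 \<gamma>\<^sub>2 \<theta>. boundary_corner \<beta> \<Omega> \<gamma>\<^sub>1 \<gamma>\<^sub>2 \<theta> \<and> \<theta> < pi / 2)"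
proof
  assume "\<exists>\<gamma>\<^sub>1 \<gamma>\<^sub>2 \<theta>. boundary_corner \<beta> \<Omega> \<gamma>\<^sub>1 \<gamma>\<^sub>2 \<theta> \<and> \<theta> < pi / 2"
  then obtain \<gamma>\<^sub>1 \<gamma>\<^sub>2 \<theta> where corner: "boundary_corner \<beta> \<Omega> \<gamma>\<^sub>1 \<gamma>\<^sub>2 \<theta>" "\<theta> < pi / 2" by blast
  have \<Omega>: "open \<Omega>" "convex \<Omega>" "bounded \<Omega>" "\<Omega> \<noteq> {}"
    using assms(1) by (auto simp: bounded_convex_domain_def)
  define H where "H x = frechet_derivative (grad u) (at x)" for x
  have ct: "convex_torsion \<Omega> u (grad u) H"
    using torsion_function_convex_torsion[OF assms(1,2)] unfolding H_def[abs_def] .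
  interpret convex_torsion \<Omega> u "grad u" H by (rule ct)
  have cont: "continuous_on \<Omega> u" "continuous_on \<Omega> (grad u)"
    using second_order_continuous[OF second_order] by auto
  \<comment> \<open>Extremality supplies finiteness: the supremum equals the norm of an actual limit
    vector.\<close>
  obtain M where M: "Linf_norm \<Omega> (grad u) = ereal M"
    using assms(4) by (metis extremal_point_def)
  have le_M: "norm (grad u x) \<le> M" if "x \<in> \<Omega>" for x
    using Linf_norm_upper[OF \<Omega>(1) cont(2) that] by (simp add: M)
  have least_M: "M \<le> B" if "\<And>x. x \<in> \<Omega> \<Longrightarrow> norm (grad u x) \<le> B" for B
    using Linf_norm_least[OF \<Omega>(1) cont(2) that] by (simp add: M)
  obtain z where z: "z \<in> \<Omega>" "grad u z \<noteq> 0" using gradient_not_identically_zero[OF ct \<Omega>(4)] by blast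
  have M0: "0 < M" using le_M[OF z(1)] z(2) by (meson less_le_trans zero_less_norm_iff)
  have open_area: "0 < measure lebesgue S" if "open S" "bounded S" "S \<noteq> {}" for S :: "(real^2) set"
    using that open_not_negligible[of S] negligible_iff_measure[of S] lmeasurable_open[of S]
      measure_nonneg[of lebesgue S] by (metis less_eq_real_def)
  define A where "A = measure lebesgue \<Omega>"
  have A: "0 < A" unfolding A_def using open_area \<Omega> by blast
  obtain V e n a b where en: "e \<bullet> e = 1" "n \<bullet> n = 1" "e \<bullet> n = 0" and ab: "0 < a" "0 < b"
    and side: "\<And>w. w \<in> \<Omega> \<Longrightarrow> 0 < (w - V) \<bullet> n"
    and wedge: "\<And>w. w \<in> \<Omega> \<Longrightarrow> (w - V) \<bullet> n < a * ((w - V) \<bullet> e)"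
    and cone: "\<And>\<delta>. 0 < \<delta> \<Longrightarrow> \<exists>\<eta>>0. \<forall>x y. 0 < x \<and> x < \<eta> \<and> \<delta> * x < y \<and> y < b * x \<longrightarrow> V + x *\<^sub>R e + y *\<^sub>R n \<in> \<Omega>"
    by (rule corner_coordinates[OF \<Omega>(1,2,4) corner]) (rule that)
  \<comment> \<open>The threshold says that M^2 times the removed area N c/(4a) exceeds 6 c A, the
    gradient loss times the area.\<close>
  obtain N :: nat where N: "24 * a * A / M\<^sup>2 < real N" using reals_Archimedean2 by blast
  have op: "open {w \<in> \<Omega>. c < u w}" for c
    using continuous_open_preimage[OF cont(1) \<Omega>(1), of "{c<..}"] by (simp add: vimage_def Int_def)
  \<comment> \<open>Taking c below half of \<open>u z\<close> puts \<open>z\<close> in the level set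
    for 2 c as well, as \<open>gradient_drop\<close> requires.\<close>
  have "0 < u z / 2" using pos[OF z(1)] by simp
  obtain c where c: "0 < c" "c < u z / 2"
    and area: "measure lebesgue {w \<in> \<Omega>. c < u w} \<le> A - N * (c / (4 * a))"
    using corner_sublevel_area[OF \<Omega>(1,3) en ab wedge_barrier[OF ct en(3,2) side wedge] cone op \<open>0 < u z / 2\<close>]
    unfolding A_def by blast
  define \<Omega>' where "\<Omega>' = {w \<in> \<Omega>. c < u w}"
  define A' where "A' = measure lebesgue \<Omega>'"
  have z': "z \<in> \<Omega>'" using z(1) c by (simp add: \<Omega>'_def)
  have \<Omega>': "bounded_convex_domain \<Omega>'" "torsion_function \<Omega>' (\<lambda>x. u x - c)"
    using superlevel_torsion[OF assms(1,2) c(1)] z' unfolding \<Omega>'_def by blast+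
  have A': "0 < A'" unfolding A'_def using open_area \<Omega>'(1) by (auto simp: bounded_convex_domain_def)
  have op': "open \<Omega>'" and cont': "continuous_on \<Omega>' (grad u)"
    using op continuous_on_subset[OF cont(2)] by (auto simp: \<Omega>'_def)
  have "Linf_norm \<Omega>' (grad u) \<le> ereal M"
    by (rule Linf_norm_least[OF op' cont']) (use le_M in \<open>auto simp: \<Omega>'_def\<close>)
  moreover have "ereal (norm (grad u z)) \<le> Linf_norm \<Omega>' (grad u)"
    by (rule Linf_norm_upper[OF op' cont' z'])
  ultimately obtain Q where Q: "Linf_norm \<Omega>' (grad u) = ereal Q"
    by (cases "Linf_norm \<Omega>' (grad u)") auto
  have le_Q: "norm (grad u y) \<le> Q" if "y \<in> \<Omega>'" for y
    using Linf_norm_upper[OF op' cont' that] by (simp add: Q)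
  have Q0: "0 \<le> Q" using le_Q[OF z'] norm_ge_zero order_trans by blast
  have "ereal Q / ereal (sqrt A') \<le> ereal M / ereal (sqrt A)"
    using maximizer[OF \<Omega>'] by (simp add: gradient_ratio_def grad_diff_const M Q A_def A'_def)
  then have "Q / sqrt A' \<le> M / sqrt A" using A A' by simp
  then have "(Q / sqrt A')\<^sup>2 \<le> (M / sqrt A)\<^sup>2" using Q0 A' by (intro power_mono) auto
  then have QM: "Q\<^sup>2 * A \<le> M\<^sup>2 * A'" using A A' by (simp add: power_divide field_simps)
  \<comment> \<open>The level 2 c is used because \<open>gradient_drop\<close> yields a point with a
    non-strict bound, whereas \<open>\<Omega>'\<close> is cut out by the strict c < u. This turns
    the loss 3 c into 6 c.\<close>
  have "norm (grad u x) \<le> sqrt (Q\<^sup>2 + 6 * c)" if x: "x \<in> \<Omega>" for x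
  proof -
    obtain y where y: "y \<in> \<Omega>" "2 * c \<le> u y" "(norm (grad u x))\<^sup>2 \<le> (norm (grad u y))\<^sup>2 + 3 * (2 * c)"
      using gradient_drop[OF ct z(1) _ _ x, of "2 * c"] c by auto
    then have "(norm (grad u y))\<^sup>2 \<le> Q\<^sup>2" using c by (intro power_mono le_Q) (auto simp: \<Omega>'_def)
    then show ?thesis using y(3) by (intro real_le_rsqrt) simp
  qed
  then have "M \<le> sqrt (Q\<^sup>2 + 6 * c)" by (rule least_M)
  then have "M\<^sup>2 \<le> Q\<^sup>2 + 6 * c" using M0 c by (metis less_imp_le real_le_lsqrt real_sqrt_le_iff real_sqrt_unique sqrt_le_D)
  then have "M\<^sup>2 * A \<le> (Q\<^sup>2 + 6 * c) * A" using A by (intro mult_right_mono) auto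
  also have "\<dots> \<le> M\<^sup>2 * A' + 6 * c * A" using QM by (simp add: algebra_simps)
  also have "\<dots> \<le> M\<^sup>2 * (A - N * (c / (4 * a))) + 6 * c * A"
    using area by (intro add_right_mono mult_left_mono) (auto simp: A'_def \<Omega>'_def)
  finally have "M\<^sup>2 * (N * (c / (4 * a))) \<le> 6 * c * A" by (simp add: algebra_simps)
  then have "M\<^sup>2 * N \<le> 24 * a * A" using c ab by (simp add: field_simps)
  moreover have "24 * a * A < M\<^sup>2 * N" using N M0 by (simp add: field_simps)
  ultimately show False by simp
qed

end
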